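(* Let $\Omega\subset\mathbb{R}^2$ be a bounded simply-connected Lipschitz domain with piecewise straight (polygonal) boundary and let $\mathcal{G}_h$ be a (regular) subdivision of $\Omega$ into convex quadrilaterals. Let $V^{\rm RQM}_{h0}$ be the homogeneous reduced quadrilateral Morley space and $\mathring{V}^{\rm PS}_{h0}$ the space of cellwise divergence-free vector Park–Sheen functions on $\mathcal{G}_h$. Then $$\operatorname{curl}_h V^{\rm RQM}_{h0}=\mathring{V}^{\rm PS}_{h0},$$ where $\operatorname{curl}_h$ is the cell-by-cell curl.
   Context: $\mathcal{G}_h$ is conforming (edge-to-edge). For a scalar function $\varphi$, $\operatorname{curl}\varphi=(\partial_y\varphi,-\partial_x\varphi)$ (the gradient rotated by a right angle); $\operatorname{curl}_h$ and $\operatorname{div}_h$ denote the operators applied cell by cell. Reduced quadrilateral Morley space: $V^{\rm RQM}_{h0}$ is the set of $v_h\in L^2(\Omega)$ such that $v_h|_Q\in P_2(Q)$ (total degree at most 2) for every $Q\in\mathcal{G}_h$; $v_h$ is continuous at every vertex of $\mathcal{G}_h$ and vanishes at every boundary vertex; $\int_e\frac{\partial v_h}{\partial n_e}\,ds$ is continuous across every interior edge $e$ (values from both sides agree, for a fixed unit normal $n_e$ of $e$) and vanishes on every boundary edge $e$. Park–Sheen space: $V^{\rm PS}_{h0}$ is the set of $w_h\in L^2(\Omega)$ such that $w_h|_Q\in P_1(Q)$ for every $Q\in\mathcal{G}_h$, the average of $w_h$ over $e$ is continuous across every interior edge $e$, and the average of $w_h$ over $e$ is zero for every boundary edge $e$.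 Then $\mathring{V}^{\rm PS}_{h0}=\{v_h\in (V^{\rm PS}_{h0})^2:\operatorname{div}_h v_h=0\}$. Regularity: for a convex quadrilateral $Q$ with vertices $a_1,\dots,a_4$ in counterclockwise order and edges $e_1=a_1a_2$, $e_2=a_2a_3$, $e_3=a_3a_4$, $e_4=a_4a_1$ with midpoints $m_i$, let $O=m_1m_3\cap m_2m_4$, $\mathbf r=\overrightarrow{Om_3}$, $\mathbf s=\overrightarrow{Om_4}$, and $\mathcal R_Q=\max\{\frac{|\mathbf r||\mathbf s|}{\mathbf r\times\mathbf s},\frac{|\mathbf r|}{|\mathbf s|},\frac{|\mathbf s|}{|\mathbf r|}\}$; a family of subdivisions is regular if the $\mathcal R_Q$ are uniformly bounded over all cells of all members. *)

theory Defs
  imports "HOL-Analysis.Analysis"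
begin

section \<open>The domain\<close>

text \<open>Near each boundary point, in suitable orthogonal coordinates \<open>T\<close>, the domain is the region
  strictly below the graph of a Lipschitz function.\<close>

definition lipschitz_domain :: "(real^2) set \<Rightarrow> bool" where
  "lipschitz_domain \<Omega> \<longleftrightarrow>
     \<Omega> \<noteq> {} \<and> open \<Omega> \<and> connected \<Omega> \<and>
     (\<forall>x\<in>frontier \<Omega>. \<exists>U T g L.
        open U \<and> x \<in> U \<and> orthogonal_transformation (T :: real^2 \<Rightarrow> real^2) \<and>
        lipschitz_on L UNIV (g :: real \<Rightarrow> real) \<and>
        \<Omega> \<inter> U = {y \<in> U. T y $ 2 < g (T y $ 1)})"

definition polygonal_boundary :: "(real^2) set \<Rightarrow> bool" where
  "polygonal_boundary \<Omega> \<longleftrightarrow>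
     (\<exists>S. finite S \<and> (\<forall>s\<in>S. \<exists>a b. s = closed_segment a b) \<and> frontier \<Omega> = \<Union>S)"


section \<open>Convex quadrilaterals and subdivisions\<close>

definition cross2 :: "real^2 \<Rightarrow> real^2 \<Rightarrow> real" where
  "cross2 u v = u $ 1 * v $ 2 - u $ 2 * v $ 1"

text \<open>A closed quadrilateral with counterclockwise vertices \<open>a1, a2, a3, a4\<close>. Four left turns
  force strict convexity: the exterior angles lie in \<open>(0, \<pi>)\<close> and add up to a multiple of \<open>2\<pi>\<close>
  below \<open>4\<pi>\<close>.\<close>

definition convex_quad ::
    "(real^2) set \<Rightarrow> real^2 \<Rightarrow> real^2 \<Rightarrow> real^2 \<Rightarrow> real^2 \<Rightarrow> bool" where
  "convex_quad Q a1 a2 a3 a4 \<longleftrightarrow>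
     cross2 (a2 - a1) (a3 - a2) > 0 \<and> cross2 (a3 - a2) (a4 - a3) > 0 \<and>
     cross2 (a4 - a3) (a1 - a4) > 0 \<and> cross2 (a1 - a4) (a2 - a1) > 0 \<and>
     Q = convex hull {a1, a2, a3, a4}"

text \<open>The last condition is the edge-to-edge property; it also makes the interiors of distinct
  cells disjoint.\<close>

definition subdivision :: "(real^2) set \<Rightarrow> (real^2) set set \<Rightarrow> bool" where
  "subdivision \<Omega> G \<longleftrightarrow>
     finite G \<and> (\<forall>Q\<in>G. \<exists>a1 a2 a3 a4. convex_quad Q a1 a2 a3 a4) \<and> \<Union>G = closure \<Omega> \<and>
     (\<forall>Q\<in>G. \<forall>Q'\<in>G. Q = Q' \<or>
        Q \<inter> Q' = {} \<or>
        (\<exists>a. Q \<inter> Q' = {a} \<and> a extreme_point_of Q \<and> a extreme_point_of Q') \<or>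
        ((Q \<inter> Q') edge_of Q \<and> (Q \<inter> Q') edge_of Q'))"

definition quad_ratio :: "real^2 \<Rightarrow> real^2 \<Rightarrow> real^2 \<Rightarrow> real^2 \<Rightarrow> real" where
  "quad_ratio a1 a2 a3 a4 =
     (let m1 = midpoint a1 a2; m2 = midpoint a2 a3; m3 = midpoint a3 a4; m4 = midpoint a4 a1;
          p = (THE p. closed_segment m1 m3 \<inter> closed_segment m2 m4 = {p});
          r = m3 - p; s = m4 - p
      in Max {norm r * norm s / cross2 r s, norm r / norm s, norm s / norm r})"

definition regular_family :: "(real^2) set set set \<Rightarrow> bool" where
  "regular_family \<G> \<longleftrightarrow>
     (\<exists>C. \<forall>G\<in>\<G>. \<forall>Q\<in>G. \<forall>a1 a2 a3 a4.
        convex_quad Q a1 a2 a3 a4 \<longrightarrow> quad_ratio a1 a2 a3 a4 \<le> C)"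


section \<open>Piecewise polynomial functions in \<open>L\<^sup>2\<close>\<close>

text \<open>Elements of \<open>L\<^sup>2(\<Omega>)\<close> are handled through representatives: \<open>sq_integrable \<Omega>\<close> is the set of
  representatives, and \<open>ae_class \<Omega> f\<close> is the element represented by \<open>f\<close>. Values outside \<open>\<Omega>\<close> are
  irrelevant.\<close>

definition sq_integrable :: "(real^2) set \<Rightarrow> (real^2 \<Rightarrow> real) set" where
  "sq_integrable \<Omega> =
     {f. f \<in> borel_measurable (lebesgue_on \<Omega>) \<and> integrable (lebesgue_on \<Omega>) (\<lambda>x. (f x)\<^sup>2)}"

definition ae_class :: "(real^2) set \<Rightarrow> (real^2 \<Rightarrow> 'b) \<Rightarrow> (real^2 \<Rightarrow> 'b) set" where
  "ae_class \<Omega> f = {g. AE x in lebesgue_on \<Omega>. g x = f x}"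

definition polys :: "nat \<Rightarrow> (real^2 \<Rightarrow> real) set" where
  "polys k = {p. \<exists>c. \<forall>x. p x = (\<Sum>i\<le>k. \<Sum>j\<le>k - i. c i j * (x $ 1) ^ i * (x $ 2) ^ j)}"

definition cellwise_poly :: "nat \<Rightarrow> (real^2) set set \<Rightarrow> (real^2 \<Rightarrow> real) \<Rightarrow> bool" where
  "cellwise_poly k G v \<longleftrightarrow> (\<forall>Q\<in>G. \<exists>p\<in>polys k. AE x in lebesgue_on Q. v x = p x)"

text \<open>The restriction of \<open>v\<close> to a cell, as a polynomial on the whole plane: vertex values, edge
  integrals and derivatives of \<open>v\<close> seen from \<open>Q\<close> are those of this polynomial. It is unique
  because a cell has nonempty interior.\<close>

definition cell_poly :: "(real^2 \<Rightarrow> real) \<Rightarrow> (real^2) set \<Rightarrow> real^2 \<Rightarrow> real" where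
  "cell_poly v Q = (THE p. (\<exists>k. p \<in> polys k) \<and> (AE x in lebesgue_on Q. v x = p x))"

definition edge_integral :: "real^2 \<Rightarrow> real^2 \<Rightarrow> (real^2 \<Rightarrow> real) \<Rightarrow> real" where
  "edge_integral a b f = integral {0..1} (\<lambda>t. f (linepath a b t) * dist a b)"

definition edge_average :: "real^2 \<Rightarrow> real^2 \<Rightarrow> (real^2 \<Rightarrow> real) \<Rightarrow> real" where
  "edge_average a b f = edge_integral a b f / dist a b"

definition unit_normal :: "real^2 \<Rightarrow> real^2 \<Rightarrow> real^2 \<Rightarrow> bool" where
  "unit_normal a b n \<longleftrightarrow> norm n = 1 \<and> n \<bullet> (b - a) = 0"

definition dir_deriv :: "real^2 \<Rightarrow> (real^2 \<Rightarrow> real) \<Rightarrow> real^2 \<Rightarrow> real" where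
  "dir_deriv n f x = frechet_derivative f (at x) n"

definition curl :: "(real^2 \<Rightarrow> real) \<Rightarrow> real^2 \<Rightarrow> real^2" where
  "curl \<phi> x = vector [dir_deriv (axis 2 1) \<phi> x, - dir_deriv (axis 1 1) \<phi> x]"

text \<open>The cell interiors are pairwise disjoint, so at most one summand is nonzero; the null set
  of cell boundaries gets the value 0.\<close>

definition curl_h :: "(real^2) set set \<Rightarrow> (real^2 \<Rightarrow> real) \<Rightarrow> real^2 \<Rightarrow> real^2" where
  "curl_h G v x = (\<Sum>Q\<in>G. indicat_real (interior Q) x *\<^sub>R curl (cell_poly v Q) x)"

definition div_h :: "(real^2) set set \<Rightarrow> (real^2 \<Rightarrow> real^2) \<Rightarrow> real^2 \<Rightarrow> real" where
  "div_h G w x = (\<Sum>Q\<in>G. indicat_real (interior Q) x *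
     (\<Sum>i\<in>UNIV. dir_deriv (axis i 1) (cell_poly (\<lambda>y. w y $ i) Q) x))"


section \<open>The finite element spaces\<close>

text \<open>In a conforming subdivision of a Lipschitz domain, an edge or vertex is a boundary edge or
  vertex iff it is contained in \<open>frontier \<Omega>\<close>, and the interior edges are those shared by two
  distinct cells. Quantifying over both unit normals of an edge is harmless, since the conditions
  are invariant under \<open>n \<mapsto> -n\<close>.\<close>

definition RQM0 :: "(real^2) set \<Rightarrow> (real^2) set set \<Rightarrow> (real^2 \<Rightarrow> real) set" where
  "RQM0 \<Omega> G = {v \<in> sq_integrable \<Omega>. cellwise_poly 2 G v \<and>
     (\<forall>Q\<in>G. \<forall>Q'\<in>G. \<forall>a. a extreme_point_of Q \<and> a extreme_point_of Q' \<longrightarrow>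
        cell_poly v Q a = cell_poly v Q' a) \<and>
     (\<forall>Q\<in>G. \<forall>a. a extreme_point_of Q \<and> a \<in> frontier \<Omega> \<longrightarrow> cell_poly v Q a = 0) \<and>
     (\<forall>Q\<in>G. \<forall>Q'\<in>G. \<forall>a b n.
        Q \<noteq> Q' \<and> closed_segment a b edge_of Q \<and> closed_segment a b edge_of Q' \<and>
        unit_normal a b n \<longrightarrow>
        edge_integral a b (dir_deriv n (cell_poly v Q)) =
        edge_integral a b (dir_deriv n (cell_poly v Q'))) \<and>
     (\<forall>Q\<in>G. \<forall>a b n.
        closed_segment a b edge_of Q \<and> closed_segment a b \<subseteq> frontier \<Omega> \<and> unit_normal a b n \<longrightarrow>
        edge_integral a b (dir_deriv n (cell_poly v Q)) = 0)}"

definition PS0 :: "(real^2) set \<Rightarrow> (real^2) set set \<Rightarrow> (real^2 \<Rightarrow> real) set" where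
  "PS0 \<Omega> G = {w \<in> sq_integrable \<Omega>. cellwise_poly 1 G w \<and>
     (\<forall>Q\<in>G. \<forall>Q'\<in>G. \<forall>a b.
        Q \<noteq> Q' \<and> closed_segment a b edge_of Q \<and> closed_segment a b edge_of Q' \<longrightarrow>
        edge_average a b (cell_poly w Q) = edge_average a b (cell_poly w Q')) \<and>
     (\<forall>Q\<in>G. \<forall>a b.
        closed_segment a b edge_of Q \<and> closed_segment a b \<subseteq> frontier \<Omega> \<longrightarrow>
        edge_average a b (cell_poly w Q) = 0)}"

definition PS0_divfree :: "(real^2) set \<Rightarrow> (real^2) set set \<Rightarrow> (real^2 \<Rightarrow> real^2) set" where
  "PS0_divfree \<Omega> G =
     {w. (\<forall>i. (\<lambda>x. w x $ i) \<in> PS0 \<Omega> G) \<and> (AE x in lebesgue_on \<Omega>. div_h G w x = 0)}"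

end

theory Submission
  imports Defs "HOL-Complex_Analysis.Riemann_Mapping"
begin

text \<open>Let \<open>v\<close> be piecewise quadratic. Its curl is the gradient turned by a right angle, so it is
  piecewise affine and divergence-free, and the average of an affine function over an edge is its
  value at the midpoint. The gradient of a quadratic at the midpoint of an edge has as tangential
  component the difference quotient of the endpoint values, and as normal component the mean of the
  normal derivative. Hence continuity of \<open>v\<close> at the vertices and of the edge means of
  its normal derivative gives continuity of the edge averages of the curl
  (\<open>midpoint_gradient_unique\<close>), with the corresponding zero conditions on the boundary. This is
  one inclusion, \<open>curl_h_in_PS0_divfree\<close>.

  Conversely, a divergence-free piecewise affine field has a quadratic stream function on each cell
  (\<open>curl_potential\<close>), unique up to a constant. Equal edge averages mean that the stream functions
  of neighbouring cells have equal increments along a common edge, and that increments along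
  boundary edges vanish. It remains to choose the constants so that the vertex values match and
  vanish on the boundary (\<open>vertex_potential\<close>), and this is a question about the topology of the
  domain.

  The choice is a gluing problem in the plane. Along the edges the vertex
  values are interpolated linearly, and the complement of the domain is added to the cells as one
  more piece, with the function zero. The pieces then cover the whole plane, and near each point
  their functions have consistent increments, so they are locally the restrictions of one function
  up to constants. In the plane such local data always come from a global function
  (\<open>global_potential\<close>, \<open>glue_over_closed_cover\<close>), which is shown by growing a ball.
  Simple connectedness enters as connectedness of the complement: the global function is constant
  there, so that one subtraction gives zero values on all of the boundary. Finally, for the complement
  to fit with the cells it must be bounded by cell edges (\<open>frontier_covered_by_edges\<close>), and this
  is where the domain being on one side of its boundary, a consequence of the Lipschitz condition,
  is used.\<close>

section \<open>Local functions modulo constants\<close>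

text \<open>Potentials are only ever determined up to an additive constant, so the natural local relation
  between two functions is equality up to a constant near a point.\<close>

definition parallel_at :: "('a::topological_space \<Rightarrow> real) \<Rightarrow> ('a \<Rightarrow> real) \<Rightarrow> 'a \<Rightarrow> bool" where
  "parallel_at f g x \<longleftrightarrow> (\<exists>c. \<forall>\<^sub>F y in nhds x. f y = g y + c)"

lemma parallel_atI: "(\<forall>\<^sub>F y in nhds x. f y = g y + c) \<Longrightarrow> parallel_at f g x"
  unfolding parallel_at_def by blast

lemma parallel_at_sym: "parallel_at f g x \<Longrightarrow> parallel_at g f x"
proof -
  assume "parallel_at f g x"
  then obtain c where "\<forall>\<^sub>F y in nhds x. f y = g y + c"
    unfolding parallel_at_def by blast
  then have "\<forall>\<^sub>F y in nhds x. g y = f y + (- c)" by eventually_elim simp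
  then show ?thesis by (rule parallel_atI)
qed

lemma parallel_at_trans:
  assumes "parallel_at f g x" "parallel_at g h x" shows "parallel_at f h x"
proof -
  obtain c d where c: "\<forall>\<^sub>F y in nhds x. f y = g y + c" and d: "\<forall>\<^sub>F y in nhds x. g y = h y + d"
    using assms unfolding parallel_at_def by blast
  from c d have "\<forall>\<^sub>F y in nhds x. f y = h y + (d + c)" by eventually_elim simp
  then show ?thesis by (rule parallel_atI)
qed

lemma parallel_at_on_open:
  assumes "open U" "x \<in> U" "\<And>y. y \<in> U \<Longrightarrow> f y = g y + c"
  shows "parallel_at f g x"
  using assms by (intro parallel_atI[where c=c]) (auto simp: eventually_nhds)

text \<open>The difference is locally constant, hence constant on a connected set.\<close>

lemma parallel_at_imp_constant_difference:
  assumes "connected A" and "\<And>x. x \<in> A \<Longrightarrow> parallel_at f g x"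
  shows "\<exists>c. \<forall>x\<in>A. f x = g x + c"
proof (cases "A = {}")
  case False
  then obtain a where a: "a \<in> A" by blast
  have loc: "\<forall>x\<in>A. \<forall>\<^sub>F y in at x within A. f x - g x = f y - g y"
  proof
    fix x assume "x \<in> A"
    then obtain c where c: "\<forall>\<^sub>F y in nhds x. f y = g y + c"
      using assms(2) unfolding parallel_at_def by blast
    then have x: "f x = g x + c" by (rule eventually_nhds_x_imp_x)
    have "\<forall>\<^sub>F y in nhds x. f x - g x = f y - g y"
      using c by eventually_elim (use x in simp)
    then show "\<forall>\<^sub>F y in at x within A. f x - g x = f y - g y"
      by (simp add: eventually_at_filter eventually_mono)
  qed
  have "f x - g x = f a - g a" if "x \<in> A" for x
    using connected_local_const[OF assms(1) that a loc] .
  then show ?thesis by (intro exI[of _ "f a - g a"]) (auto simp: algebra_simps)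
qed auto

text \<open>A family of local functions, one at each point \<open>x\<close> and meant to be used near \<open>x\<close>, any two of
  which agree up to a constant where they are both used. Their germs modulo constants form a
  locally constant system, and \<open>global_potential\<close> below says that on Euclidean space such a
  system has a global section.\<close>

locale coherent_germs =
  fixes \<Phi> :: "'a::euclidean_space \<Rightarrow> 'a \<Rightarrow> real"
  assumes coherent: "\<And>x. \<forall>\<^sub>F y in nhds x. parallel_at (\<Phi> x) (\<Phi> y) y"
begin

definition potential_on :: "'a set \<Rightarrow> ('a \<Rightarrow> real) \<Rightarrow> bool" where
  "potential_on U F \<longleftrightarrow> (\<forall>x\<in>U. parallel_at F (\<Phi> x) x)"

lemma potential_on_subset: "potential_on U F \<Longrightarrow> V \<subseteq> U \<Longrightarrow> potential_on V F"
  unfolding potential_on_def by blast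

lemma potential_unique:
  assumes "connected U" "potential_on U F" "potential_on U H"
  shows "\<exists>c. \<forall>x\<in>U. F x = H x + c"
  using assms parallel_at_trans parallel_at_sym unfolding potential_on_def
  by (intro parallel_at_imp_constant_difference) blast+

lemma potential_on_cong:
  assumes "potential_on U F" "open U" "\<And>x. x \<in> U \<Longrightarrow> H x = F x + c"
  shows "potential_on U H"
  using assms parallel_at_on_open[of U _ H F c] parallel_at_trans unfolding potential_on_def
  by blast

lemma potential_on_Union:
  assumes "\<And>U. U \<in> \<U> \<Longrightarrow> potential_on U F" shows "potential_on (\<Union>\<U>) F"
  using assms unfolding potential_on_def by blast

text \<open>Potentials on concentric balls, normalised to vanish at the common centre, agree wherever two of
  them are defined, so they can be combined. This serves both the supremum of the admissible radii
  and the passage to the whole space.\<close>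

lemma potential_on_union_of_balls:
  assumes A: "\<And>R. R \<in> A \<Longrightarrow> \<exists>F. potential_on (ball 0 R) F"
  shows "\<exists>F. potential_on (\<Union>R\<in>A. ball 0 R) F"
proof -
  have "\<exists>F. potential_on (ball 0 R) F \<and> F 0 = 0" if R: "R \<in> A" for R
  proof -
    obtain F where F: "potential_on (ball 0 R) F" using A[OF R] by blast
    then have "potential_on (ball 0 R) (\<lambda>x. F x - F 0)"
      by (rule potential_on_cong[where c="- F 0"]) auto
    then show ?thesis by (intro exI[of _ "\<lambda>x. F x - F 0"]) simp
  qed
  then obtain F where F: "\<And>R. R \<in> A \<Longrightarrow> potential_on (ball 0 R) (F R)"
    and F0: "\<And>R. R \<in> A \<Longrightarrow> F R 0 = 0" by metis
  have agree: "F R x = F S x" if RS: "R \<in> A" "S \<in> A" "R \<le> S" "x \<in> ball 0 R" for R S x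
  proof -
    have "potential_on (ball 0 R) (F S)"
      by (rule potential_on_subset[OF F[OF RS(2)]]) (use RS in auto)
    then obtain c where c: "\<forall>x\<in>ball 0 R. F R x = F S x + c"
      using potential_unique[OF connected_ball F[OF RS(1)]] by blast
    moreover have "(0::'a) \<in> ball 0 R"
      using RS(4) norm_ge_zero[of x] by (auto simp del: norm_ge_zero)
    ultimately have "F R 0 = F S 0 + c" by blast
    then have "c = 0" using F0 RS by simp
    then show ?thesis using c RS by simp
  qed
  define H where "H x = F (SOME R. R \<in> A \<and> x \<in> ball 0 R) x" for x
  have H: "H x = F R x" if "R \<in> A" "x \<in> ball 0 R" for R x
  proof -
    define S where "S = (SOME R. R \<in> A \<and> x \<in> ball 0 R)"
    have "S \<in> A \<and> x \<in> ball 0 S" unfolding S_def by (rule someI) (use that in blast)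
    then show ?thesis
      using agree[of R S x] agree[of S R x] that unfolding H_def S_def[symmetric] by linarith
  qed
  have "potential_on (\<Union>R\<in>A. ball 0 R) H"
  proof (rule potential_on_Union)
    fix U :: "'a set" assume "U \<in> (\<lambda>R. ball 0 R) ` A"
    then obtain R where R: "R \<in> A" and U: "U = ball 0 R" by auto
    show "potential_on U H" unfolding U
      by (rule potential_on_cong[OF F[OF R], where c=0]) (use H[OF R] in auto)
  qed
  then show ?thesis by blast
qed

text \<open>This is where the roundness of the ball enters. Two overlapping balls centred on a sphere overlap
  on the segment between their centres, and the interior of a chord of the sphere lies strictly
  inside. For equal centres a small radial shift does the job.\<close>

lemma balls_on_sphere_meet_inside:
  fixes x y :: 'a
  assumes R: "0 < R" and x: "norm x = R" "norm y = R" and z: "z \<in> ball x r" "z \<in> ball y s"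
  shows "\<exists>w. w \<in> ball x r \<and> w \<in> ball y s \<and> norm w < R"
proof (cases "x = y")
  case True
  have rs: "0 < min r s" using z by (auto intro: le_less_trans[OF zero_le_dist])
  define t where "t = min (1/2) (min r s / (2 * R))"
  have t: "0 < t" "t < 1" "t * R \<le> min r s / 2"
  proof -
    show "0 < t" "t < 1" using rs R by (auto simp: t_def)
    have "t * R \<le> min r s / (2 * R) * R" unfolding t_def using R by (intro mult_right_mono) auto
    then show "t * R \<le> min r s / 2" using R by simp
  qed
  have "dist x ((1 - t) *\<^sub>R x) = norm (t *\<^sub>R x)"
    by (simp add: dist_norm algebra_simps)
  also have "\<dots> = t * R" using x t by simp
  finally have "dist x ((1 - t) *\<^sub>R x) < min r s" using t rs by linarith
  moreover have "norm ((1 - t) *\<^sub>R x) < R" using t x R by simp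
  ultimately show ?thesis using True by (intro exI[of _ "(1 - t) *\<^sub>R x"]) auto
next
  case False
  have pos: "0 < r" "0 < s" using z by (auto intro: le_less_trans[OF zero_le_dist])
  have d: "dist x y < r + s" using z dist_triangle[of x y z] by (auto simp: dist_commute)
  define t where "t = r / (r + s)"
  have t: "0 < t" "t < 1" using pos by (auto simp: t_def)
  define w where "w = (1 - t) *\<^sub>R x + t *\<^sub>R y"
  have "dist x w = t * dist x y"
  proof -
    have "x - w = t *\<^sub>R (x - y)" unfolding w_def by (simp add: algebra_simps)
    then show ?thesis using t by (simp add: dist_norm)
  qed
  also have "\<dots> < t * (r + s)" using d t by simp
  also have "\<dots> = r" using pos by (simp add: t_def)
  finally have xw: "dist x w < r" .
  have "dist y w = (1 - t) * dist x y"
  proof -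
    have "y - w = (1 - t) *\<^sub>R (y - x)" unfolding w_def by (simp add: algebra_simps)
    then show ?thesis using t by (simp add: dist_norm norm_minus_commute)
  qed
  also have "\<dots> < (1 - t) * (r + s)" using d t by simp
  also have "\<dots> = s" using pos by (simp add: t_def field_simps)
  finally have yw: "dist y w < s" .
  have "w \<in> open_segment x y" using False t unfolding w_def in_segment by blast
  then have "dist 0 w < max (dist 0 x) (dist 0 y)"
    using dist_decreases_open_segment[of w x y 0]
    by (smt (verit) max.coboundedI1 max_less_iff_conj)
  then have "norm w < R" using x by simp
  then show ?thesis using xw yw by auto
qed

text \<open>Around every point \<open>x\<close> of the sphere, a unique constant makes the local function match \<open>F\<close> on the
  convex, hence connected, part of its ball inside the sphere. Two such corrected functions agree on
  the overlap of their balls: the overlap is connected and, by the previous lemma, it reaches a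
  region where both agree with \<open>F\<close>. Compactness of the closed ball yields a uniform gain in radius.\<close>

lemma potential_extends_beyond_ball:
  assumes R: "0 < R" and F: "potential_on (ball 0 R) F"
  shows "\<exists>\<epsilon>>0. \<exists>H. potential_on (ball 0 (R + \<epsilon>)) H"
proof -
  have "\<exists>r>0. potential_on (ball x r) (\<Phi> x)" for x
    using coherent[of x] unfolding eventually_nhds_metric potential_on_def
    by (metis dist_commute mem_ball)
  then obtain r where r: "\<And>x. 0 < r x" "\<And>x. potential_on (ball x (r x)) (\<Phi> x)" by metis
  have "\<exists>c. \<forall>y\<in>ball x (r x) \<inter> ball 0 R. F y = \<Phi> x y + c" for x
  proof (rule potential_unique)
    show "connected (ball x (r x) \<inter> ball 0 R)" by (intro convex_connected convex_Int convex_ball)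
    show "potential_on (ball x (r x) \<inter> ball 0 R) F"
      by (rule potential_on_subset[OF F]) auto
    show "potential_on (ball x (r x) \<inter> ball 0 R) (\<Phi> x)"
      by (rule potential_on_subset[OF r(2)]) auto
  qed
  then have "\<forall>x. \<exists>c. \<forall>y\<in>ball x (r x) \<inter> ball 0 R. F y = \<Phi> x y + c" by blast
  then obtain c where "\<forall>x. \<forall>y\<in>ball x (r x) \<inter> ball 0 R. F y = \<Phi> x y + c x"
    by (rule choice[THEN exE])
  then have c: "\<And>x y. y \<in> ball x (r x) \<Longrightarrow> norm y < R \<Longrightarrow> F y = \<Phi> x y + c x" by simp
  have agree: "\<Phi> x z + c x = \<Phi> y z + c y"
    if x: "norm x = R" "norm y = R" and z: "z \<in> ball x (r x)" "z \<in> ball y (r y)" for x y z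
  proof -
    let ?C = "ball x (r x) \<inter> ball y (r y)"
    have "\<exists>d. \<forall>z\<in>?C. \<Phi> x z = \<Phi> y z + d"
    proof (rule potential_unique)
      show "connected ?C" by (intro convex_connected convex_Int convex_ball)
      show "potential_on ?C (\<Phi> x)" "potential_on ?C (\<Phi> y)"
        by (rule potential_on_subset[OF r(2)]; auto)+
    qed
    then obtain d where d: "\<And>z. z \<in> ?C \<Longrightarrow> \<Phi> x z = \<Phi> y z + d" by blast
    obtain w where w: "w \<in> ball x (r x)" "w \<in> ball y (r y)" "norm w < R"
      using balls_on_sphere_meet_inside[OF R x z] by blast
    have "\<Phi> x w = \<Phi> y w + d" using d w by blast
    then have "d = c y - c x" using c[OF w(1,3)] c[OF w(2,3)] by simp
    then show ?thesis using d[of z] z by auto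
  qed
  define H where "H y = (if norm y < R then F y
      else let x = SOME x. norm x = R \<and> y \<in> ball x (r x) in \<Phi> x y + c x)" for y
  have H1: "H y = \<Phi> x y + c x" if "norm x = R" "y \<in> ball x (r x)" for x y
  proof (cases "norm y < R")
    case True
    then show ?thesis using c that by (simp add: H_def)
  next
    case False
    define x' where "x' = (SOME x. norm x = R \<and> y \<in> ball x (r x))"
    have "norm x' = R \<and> y \<in> ball x' (r x')"
      unfolding x'_def by (rule someI) (use that in blast)
    moreover have "H y = \<Phi> x' y + c x'" using False by (simp only: H_def if_False Let_def x'_def)
    ultimately show ?thesis using agree[of x x' y] that by simp
  qed
  let ?U = "ball 0 R \<union> (\<Union>x\<in>sphere 0 R. ball x (r x))"
  have "potential_on ?U H"
  proof -
    have "potential_on (ball 0 R) H"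
      by (rule potential_on_cong[OF F, where c=0]) (auto simp: H_def)
    moreover have "potential_on (ball x (r x)) H" if "norm x = R" for x
      by (rule potential_on_cong[OF r(2), where c="c x"]) (use H1[OF that] in auto)
    ultimately show ?thesis unfolding potential_on_def by auto
  qed
  moreover have "\<exists>\<epsilon>>0. ball 0 (R + \<epsilon>) \<subseteq> ?U"
  proof -
    have "cball 0 R \<subseteq> ?U" using r(1) by (auto simp: le_less)
    moreover have "open ?U" by auto
    ultimately obtain \<epsilon> where e: "\<epsilon> > 0" "(\<Union>x\<in>cball 0 R. ball x \<epsilon>) \<subseteq> ?U"
      using compact_subset_open_imp_ball_epsilon_subset[OF compact_cball] by metis
    have "ball 0 (R + \<epsilon>) \<subseteq> (\<Union>x\<in>cball (0::'a) R. ball x \<epsilon>)"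
    proof
      fix y :: 'a assume y: "y \<in> ball 0 (R + \<epsilon>)"
      show "y \<in> (\<Union>x\<in>cball 0 R. ball x \<epsilon>)"
      proof (cases "norm y \<le> R")
        case True
        then have "y \<in> cball 0 R" "y \<in> ball y \<epsilon>" using e by auto
        then show ?thesis by blast
      next
        case False
        define x where "x = (R / norm y) *\<^sub>R y"
        have nx: "norm x = R" using False R by (auto simp: x_def)
        have "y - x = (1 - R / norm y) *\<^sub>R y" by (simp add: x_def algebra_simps)
        then have "dist x y = \<bar>1 - R / norm y\<bar> * norm y" by (metis dist_commute dist_norm norm_scaleR)
        also have "\<dots> = norm y - R" using False R
          by (auto simp: abs_if field_simps)
        finally have "dist x y < \<epsilon>" using y by simp
        then show ?thesis using nx by auto
      qed
    qed
    then show ?thesis using e by blast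
  qed
  ultimately show ?thesis using potential_on_subset by blast
qed

text \<open>The radii of the balls around the origin that carry a potential form an interval which contains
  its finite supremum and can be prolonged beyond it; so every radius is admissible.\<close>

theorem global_potential: "\<exists>F. potential_on UNIV F"
proof -
  define good where "good R \<longleftrightarrow> (\<exists>F. potential_on (ball 0 R) F)" for R
  have mono: "good R" if "good S" "R \<le> S" for R S
    using that potential_on_subset subset_ball unfolding good_def by blast
  obtain r where r: "0 < r" "good r"
    using coherent[of 0] unfolding eventually_nhds_metric potential_on_def good_def
    by (metis dist_commute mem_ball)
  have all: "good R" for R
  proof (rule ccontr)
    assume bad: "\<not> good R"
    define S where "S = Sup {R. good R}"
    have bdd: "bdd_above {R. good R}" using mono bad by (intro bdd_aboveI[of _ R]) (metis mem_Collect_eq linear)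
    have "r \<le> S" unfolding S_def using r bdd by (intro cSup_upper) auto
    then have S0: "0 < S" using r by simp
    have below: "good T" if "T < S" for T
      using that less_cSup_iff[OF _ bdd, of T] r mono unfolding S_def by force
    have "\<exists>F. potential_on (\<Union>T\<in>{..<S}. ball 0 T) F"
      using below by (intro potential_on_union_of_balls) (auto simp: good_def)
    moreover have "ball 0 S \<subseteq> (\<Union>T\<in>{..<S}. ball (0::'a) T)"
      using dense by (fastforce simp: Bex_def)
    ultimately have "\<exists>F. potential_on (ball 0 S) F" using potential_on_subset by blast
    then obtain \<epsilon> where "\<epsilon> > 0" "good (S + \<epsilon>)"
      using potential_extends_beyond_ball[OF S0] unfolding good_def by blast
    then show False using bdd unfolding S_def
      by (metis S_def cSup_upper add_le_same_cancel1 mem_Collect_eq not_less)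
  qed
  then have "\<exists>F. potential_on (\<Union>R\<in>UNIV. ball 0 R) F"
    by (intro potential_on_union_of_balls) (auto simp: good_def)
  moreover have "(\<Union>R\<in>UNIV. ball (0::'a) R) = UNIV" using gt_ex by (fastforce simp: set_eq_iff)
  ultimately show ?thesis by metis
qed

end

text \<open>The form in which the global section is used: a finite closed cover of space by connected pieces,
  each with its own function \<open>q i\<close>. If near each point \<open>x\<close> some function has the increments of
  all the \<open>q i\<close> whose piece contains \<open>x\<close>, then one global function differs from every \<open>q i\<close> by a
  constant. Only finitely many closed pieces are present, so near \<open>x\<close> no other piece occurs, and
  the local functions at \<open>x\<close> and at a nearby \<open>y\<close> differ by the value at \<open>y\<close> of the former.\<close>

theorem glue_over_closed_cover:
  fixes K :: "'i \<Rightarrow> 'a::euclidean_space set" and q :: "'i \<Rightarrow> 'a \<Rightarrow> real"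
  assumes "finite I" and closed: "\<And>i. i \<in> I \<Longrightarrow> closed (K i)"
    and conn: "\<And>i. i \<in> I \<Longrightarrow> connected (K i)"
    and cover: "(\<Union>i\<in>I. K i) = UNIV"
    and compat: "\<And>x. \<exists>f. \<forall>\<^sub>F y in nhds x. \<forall>i\<in>I. x \<in> K i \<longrightarrow> y \<in> K i \<longrightarrow> f y = q i y - q i x"
  shows "\<exists>F. \<forall>i\<in>I. \<exists>c. \<forall>x\<in>K i. F x = q i x + c"
proof -
  have away: "\<forall>\<^sub>F y in nhds x. \<forall>i\<in>I. y \<in> K i \<longrightarrow> x \<in> K i" for x
  proof -
    have "\<forall>\<^sub>F y in nhds x. y \<in> K i \<longrightarrow> x \<in> K i" if "i \<in> I" for i
    proof (cases "x \<in> K i")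
      case False
      then have "\<forall>\<^sub>F y in nhds x. y \<in> - K i"
        using closed[OF that] by (intro eventually_nhds_in_open) auto
      then show ?thesis by eventually_elim simp
    qed simp
    then show ?thesis using assms(1) by (simp add: eventually_ball_finite)
  qed
  have "\<forall>x. \<exists>f. \<forall>\<^sub>F y in nhds x. \<forall>i\<in>I. x \<in> K i \<longrightarrow> y \<in> K i \<longrightarrow> f y = q i y - q i x"
    using compat by blast
  then obtain f where
    f': "\<forall>x. \<forall>\<^sub>F y in nhds x. \<forall>i\<in>I. x \<in> K i \<longrightarrow> y \<in> K i \<longrightarrow> f x y = q i y - q i x"
    by (rule choice[THEN exE])
  have f: "\<forall>\<^sub>F y in nhds x. \<forall>i\<in>I. y \<in> K i \<longrightarrow> x \<in> K i \<and> f x y = q i y - q i x" for x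
    using away[of x] f'[rule_format, of x] by eventually_elim blast
  interpret coherent_germs f
  proof
    fix x
    have "\<forall>\<^sub>F y in nhds x. \<forall>\<^sub>F z in nhds y. \<forall>i\<in>I. z \<in> K i \<longrightarrow> x \<in> K i \<and> f x z = q i z - q i x"
      using f[of x] by (simp add: eventually_eventually)
    then show "\<forall>\<^sub>F y in nhds x. parallel_at (f x) (f y) y"
    proof eventually_elim
      case (elim y)
      have xy: "\<And>i. i \<in> I \<Longrightarrow> y \<in> K i \<Longrightarrow> f x y = q i y - q i x"
        using eventually_nhds_x_imp_x[OF elim] by blast
      from elim f[of y] have "\<forall>\<^sub>F z in nhds y. f x z = f y z + f x y"
      proof eventually_elim
        case (elim z)
        obtain i where "i \<in> I" "z \<in> K i" using cover by blast
        then show ?case using elim xy by fastforce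
      qed
      then show ?case by (rule parallel_atI)
    qed
  qed
  obtain F where F: "\<And>x. parallel_at F (f x) x"
    using global_potential unfolding potential_on_def by blast
  have "\<exists>c. \<forall>x\<in>K i. F x = q i x + c" if i: "i \<in> I" for i
  proof (cases "K i = {}")
    case False
    then obtain a where a: "a \<in> K i" by blast
    have loc: "\<forall>x\<in>K i. \<forall>\<^sub>F y in at x within K i. F x - q i x = F y - q i y"
    proof
      fix x assume x: "x \<in> K i"
      obtain c where c: "\<forall>\<^sub>F y in nhds x. F y = f x y + c" using F unfolding parallel_at_def by blast
      have Fx: "F x = f x x + c" using eventually_nhds_x_imp_x[OF c] .
      have fx: "f x x = 0" using eventually_nhds_x_imp_x[OF f[of x]] i x by auto
      from c f[of x] have "\<forall>\<^sub>F y in nhds x. y \<in> K i \<longrightarrow> F x - q i x = F y - q i y"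
        by eventually_elim (use i Fx fx in auto)
      then show "\<forall>\<^sub>F y in at x within K i. F x - q i x = F y - q i y"
        by (auto simp: eventually_at_filter elim: eventually_mono)
    qed
    have "F x - q i x = F a - q i a" if "x \<in> K i" for x
      using connected_local_const[OF conn[OF i] that a loc] .
    then show ?thesis by (intro exI[of _ "F a - q i a"]) (auto simp: algebra_simps)
  qed auto
  then show ?thesis by blast
qed

section \<open>The complement of a simply connected domain\<close>

text \<open>The characterisation of bounded simply connected open sets by their connected complement is a
  theorem about the complex plane; it is transported along the linear identification with
  \<open>real^2\<close>.\<close>

lemma connected_Compl_of_simply_connected:
  fixes \<Omega> :: "(real^2) set"
  assumes "open \<Omega>" "bounded \<Omega>" "simply_connected \<Omega>"
  shows "connected (- \<Omega>)"
proof -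
  define h :: "real^2 \<Rightarrow> complex" where "h x = Complex (x $ 1) (x $ 2)" for x
  define k :: "complex \<Rightarrow> real^2" where "k z = vector [Re z, Im z]" for z
  have kh: "k (h x) = x" for x by (simp add: h_def k_def vec_eq_iff forall_2)
  have hk: "h (k z) = z" for z by (simp add: h_def k_def complex_eq_iff)
  have hl: "bounded_linear h"
    by (intro linear_conv_bounded_linear[THEN iffD1] linearI) (auto simp: h_def complex_eq_iff)
  have kl: "bounded_linear k"
    by (intro linear_conv_bounded_linear[THEN iffD1] linearI) (auto simp: k_def vec_eq_iff forall_2)
  note hc = linear_continuous_on[OF hl] and kc = linear_continuous_on[OF kl]
  have hom: "homeomorphism \<Omega> (h ` \<Omega>) h k"
    by (intro homeomorphismI hc kc) (auto simp: kh hk)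
  have bij: "bij h" using kh hk by (intro o_bij[of k]) auto
  have "h ` \<Omega> = k -` \<Omega>"
  proof (intro set_eqI iffI)
    fix z assume "z \<in> k -` \<Omega>" then show "z \<in> h ` \<Omega>" using hk[of z] by (metis imageI vimageD)
  qed (auto simp: kh)
  then have "open (h ` \<Omega>)" using kc[of UNIV] assms(1) by (simp add: open_vimage)
  moreover have "bounded (h ` \<Omega>)" using assms(2) hl by (rule bounded_linear_image)
  moreover have "simply_connected (h ` \<Omega>)"
    using assms(3) homeomorphic_simply_connected_eq[of \<Omega> "h ` \<Omega>"] hom
    unfolding homeomorphic_def by blast
  ultimately have "connected (- (h ` \<Omega>))" using simply_connected_iff_simple by blast
  then have "connected (k ` (- (h ` \<Omega>)))" by (intro connected_continuous_image kc)
  moreover have "k ` (- (h ` \<Omega>)) = - \<Omega>"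
    unfolding bij_image_Compl_eq[OF bij, symmetric] by (auto simp: image_image kh)
  ultimately show ?thesis by simp
qed

section \<open>Convex polygons\<close>

text \<open>Nonempty interior makes the edges of a polytope in the plane, its one-dimensional faces, coincide
  with its facets, so that the theory of polytopes describes its boundary.\<close>

definition polygon :: "(real^2) set \<Rightarrow> bool" where
  "polygon Q \<longleftrightarrow> polytope Q \<and> interior Q \<noteq> {}"

text \<open>A convex set with empty interior lies on a line, and one strict left turn among three of the
  vertices rules that out.\<close>

lemma convex_quad_imp_polygon:
  assumes "convex_quad Q a1 a2 a3 a4" shows "polygon Q"
proof -
  have Q: "Q = convex hull {a1, a2, a3, a4}" and c: "cross2 (a2 - a1) (a3 - a2) > 0"
    using assms by (auto simp: convex_quad_def)
  have "interior Q \<noteq> {}"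
  proof
    assume "interior Q = {}"
    then obtain n d where n: "n \<noteq> 0" and sub: "Q \<subseteq> {x. n \<bullet> x = d}"
      using empty_interior_subset_hyperplane[of Q] Q convex_convex_hull by metis
    have "a1 \<in> Q" "a2 \<in> Q" "a3 \<in> Q" unfolding Q by (auto intro: hull_inc)
    with sub have "n \<bullet> (a2 - a1) = 0" "n \<bullet> (a3 - a2) = 0" by (auto simp: inner_diff_right)
    then have e: "n$1 * (a2 - a1)$1 + n$2 * (a2 - a1)$2 = 0"
      "n$1 * (a3 - a2)$1 + n$2 * (a3 - a2)$2 = 0"
      by (simp_all add: inner_vec_def sum_2)
    have "n$1 * cross2 (a2 - a1) (a3 - a2) = 0" "n$2 * cross2 (a2 - a1) (a3 - a2) = 0"
      unfolding cross2_def using e by algebra+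
    then have "n = 0" using c by (simp add: vec_eq_iff forall_2)
    then show False using n by simp
  qed
  then show ?thesis unfolding polygon_def Q by (simp add: polytope_convex_hull)
qed

context
  fixes Q :: "(real^2) set" assumes Q: "polygon Q"
begin

lemma polygon_convex: "convex Q"
  and polygon_closed: "closed Q"
  and polygon_compact: "compact Q"
  and polygon_interior: "interior Q \<noteq> {}"
  using Q polytope_imp_convex polytope_imp_closed polytope_imp_compact by (auto simp: polygon_def)

lemma polygon_frontier: "frontier Q = \<Union>{e. e edge_of Q}"
proof -
  have "aff_dim Q = 2"
    using aff_dim_nonempty_interior[OF polygon_interior] by simp
  then have "{e. e edge_of Q} = {e. e facet_of Q}"
    by (auto simp: edge_of_def facet_of_def aff_dim_empty_eq intro: aff_dim_negative_iff)
  moreover have "frontier Q = rel_frontier Q"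
    using rel_interior_nonempty_interior[OF polygon_interior] by (simp add: frontier_def rel_frontier_def)
  ultimately show ?thesis
    using rel_frontier_of_polyhedron[OF polytope_imp_polyhedron] Q
    by (metis polygon_def)
qed

lemma edge_ends:
  assumes "closed_segment a b edge_of Q"
  shows "a \<noteq> b" and "a extreme_point_of Q" and "b extreme_point_of Q"
    and "x extreme_point_of Q \<Longrightarrow> x \<in> closed_segment a b \<Longrightarrow> x = a \<or> x = b"
proof -
  have f: "closed_segment a b face_of Q" and d: "aff_dim (closed_segment a b) = 1"
    using assms by (auto simp: edge_of_def)
  show "a \<noteq> b" using d by auto
  show "a extreme_point_of Q" "b extreme_point_of Q"
    "x extreme_point_of Q \<Longrightarrow> x \<in> closed_segment a b \<Longrightarrow> x = a \<or> x = b"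
    using extreme_point_of_face[OF f] extreme_point_of_segment by blast+
qed

lemma edge_is_segment:
  assumes "e edge_of Q" obtains a b where "e = closed_segment a b"
proof -
  have f: "e face_of Q" and d: "aff_dim e = 1" using assms by (auto simp: edge_of_def)
  have p: "polytope e" using f Q face_of_polytope_polytope by (auto simp: polygon_def)
  have "e \<noteq> {}" using d by auto
  moreover have "collinear e" using d by (simp add: collinear_aff_dim)
  ultimately show ?thesis
    using compact_convex_collinear_segment[of e] polytope_imp_compact[OF p] polytope_imp_convex[OF p] that
    by blast
qed

lemma closed_edge: "e edge_of Q \<Longrightarrow> closed e"
  by (erule edge_is_segment) simp

text \<open>The intersection of two distinct edges is a face of smaller dimension, hence a vertex.\<close>

lemma edges_meet_at_extreme_point:
  assumes e: "e edge_of Q" "e' edge_of Q" "e \<noteq> e'" and z: "z \<in> e" "z \<in> e'"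
  shows "z extreme_point_of Q"
proof -
  have f: "e face_of Q" "e' face_of Q" "aff_dim e = 1" "aff_dim e' = 1"
    using e by (auto simp: edge_of_def)
  have i: "(e \<inter> e') face_of Q" using f by (intro face_of_Int)
  have "aff_dim (e \<inter> e') < 1"
  proof (cases "e \<inter> e' = e")
    case False
    have "(e \<inter> e') face_of e" using i f(1) face_of_imp_subset[OF f(1)] by (intro face_of_subset[OF i]) auto
    then show ?thesis using face_of_aff_dim_lt[of e "e \<inter> e'"] False f face_of_imp_convex by auto
  next
    case True
    have "(e \<inter> e') face_of e'" using face_of_imp_subset[OF f(2)] by (intro face_of_subset[OF i]) auto
    then show ?thesis using face_of_aff_dim_lt[of e' "e \<inter> e'"] True e(3) f face_of_imp_convex by auto
  qed
  moreover have "aff_dim (e \<inter> e') \<ge> 0" using z by (auto simp: aff_dim_geq aff_dim_negative_iff not_less[symmetric])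
  ultimately have "aff_dim (e \<inter> e') = 0" by simp
  then obtain w where "e \<inter> e' = {w}" using aff_dim_eq_0 by blast
  then show ?thesis using i z by (auto simp: face_of_singleton)
qed

lemma finite_edges: "finite {e. e edge_of Q}"
  using Q by (intro finite_subset[OF _ finite_polytope_faces[of Q]]) (auto simp: edge_of_def polygon_def)

lemma finite_extreme_points: "finite {x. x extreme_point_of Q}"
  using Q by (intro finite_polyhedron_extreme_points polytope_imp_polyhedron) (simp add: polygon_def)

lemma extreme_point_in_edge:
  assumes "x extreme_point_of Q" obtains b where "closed_segment x b edge_of Q"
proof -
  have "x \<in> frontier Q"
    using assms extreme_point_not_in_interior[OF assms] closure_subset
    by (auto simp: frontier_def extreme_point_of_def)
  then obtain e where e: "e edge_of Q" "x \<in> e" using polygon_frontier by blast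
  obtain a b where ab: "e = closed_segment a b" using edge_is_segment[OF e(1)] .
  have "x = a \<or> x = b" using edge_ends(4)[of a b x] e assms unfolding ab by blast
  then show ?thesis using that e(1) unfolding ab by (metis closed_segment_commute)
qed

lemma edge_not_in_interior: "e edge_of Q \<Longrightarrow> z \<in> e \<Longrightarrow> z \<notin> interior Q"
  using polygon_frontier by (auto simp: frontier_def)

text \<open>Away from the vertices, the boundary of a polygon near a point of an edge is that edge only: the
  other edges are closed, finitely many, and do not contain the point.\<close>

lemma frontier_near_edge:
  assumes "e edge_of Q" "z \<in> e" "\<not> z extreme_point_of Q"
  shows "\<forall>\<^sub>F y in nhds z. y \<in> frontier Q \<longrightarrow> y \<in> e"
proof -
  have "\<forall>\<^sub>F y in nhds z. y \<notin> d" if "d \<in> {d. d edge_of Q} - {e}" for d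
  proof -
    have "z \<notin> d" using edges_meet_at_extreme_point[of d e z] that assms by auto
    moreover have "closed d" using that closed_edge by blast
    ultimately have "\<forall>\<^sub>F y in nhds z. y \<in> - d" by (intro eventually_nhds_in_open) auto
    then show ?thesis by simp
  qed
  then have "\<forall>\<^sub>F y in nhds z. \<forall>d\<in>{d. d edge_of Q} - {e}. y \<notin> d"
    using finite_edges by (intro eventually_ball_finite) auto
  then show ?thesis by eventually_elim (use polygon_frontier in auto)
qed

end

text \<open>Two cells that share an edge and do not overlap lie on opposite sides of it, so together they
  fill a neighbourhood of every non-vertex point of the edge. Indeed a small ball is cut by the line
  through the edge into two half-discs; neither meets the boundary of a cell, so each is contained
  in a given cell or disjoint from it. Each cell contains at least one half-disc, and not the same
  one, since the cells have no common interior.\<close>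

lemma common_edge_interior:
  assumes Q: "polygon Q" "polygon Q'" and disj: "interior (Q \<inter> Q') = {}"
    and e: "e edge_of Q" "e edge_of Q'" and z: "z \<in> e"
    and ne: "\<not> z extreme_point_of Q" "\<not> z extreme_point_of Q'"
  shows "z \<in> interior (Q \<union> Q')"
proof -
  have "aff_dim e = DIM(real^2) - 1" using e by (simp add: edge_of_def)
  then obtain n c where n: "n \<noteq> 0" and "affine hull e = {x. n \<bullet> x = c}"
    using aff_dim_eq_hyperplane by blast
  then have ec: "e \<subseteq> {x. n \<bullet> x = c}" using hull_subset[of e affine] by simp
  have "\<forall>\<^sub>F y in nhds z. (y \<in> frontier Q \<longrightarrow> y \<in> e) \<and> (y \<in> frontier Q' \<longrightarrow> y \<in> e)"
    using frontier_near_edge[OF Q(1) e(1) z ne(1)] frontier_near_edge[OF Q(2) e(2) z ne(2)]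
    by eventually_elim blast
  then obtain \<epsilon> where \<epsilon>: "\<epsilon> > 0"
    and fr: "\<And>y. y \<in> ball z \<epsilon> \<Longrightarrow> y \<in> frontier Q \<or> y \<in> frontier Q' \<Longrightarrow> y \<in> e"
    unfolding eventually_nhds_metric by (metis dist_commute mem_ball)
  define H1 where "H1 = ball z \<epsilon> \<inter> {x. n \<bullet> x < c}"
  define H2 where "H2 = ball z \<epsilon> \<inter> {x. n \<bullet> x > c}"
  have op: "open H1" "open H2" unfolding H1_def H2_def
    by (intro open_Int open_ball open_halfspace_lt open_halfspace_gt)+
  have co: "connected H1" "connected H2" unfolding H1_def H2_def
    by (intro convex_connected convex_Int convex_ball convex_halfspace_lt convex_halfspace_gt)+
  \<comment> \<open>The interior of \<open>P\<close> meets the ball in an open set, which cannot lie on the line, and a half-disc met by \<open>P\<close> lies in \<open>P\<close>.\<close>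
  have side: "(H1 \<noteq> {} \<and> H1 \<subseteq> P) \<or> (H2 \<noteq> {} \<and> H2 \<subseteq> P)" if P: "P = Q \<or> P = Q'" for P
  proof -
    have pP: "polygon P" "z \<in> P" using P Q z e edge_of_imp_subset by auto
    then have "z \<in> closure (interior P)"
      using convex_closure_interior[OF polygon_convex polygon_interior] closure_subset by blast
    then have "ball z \<epsilon> \<inter> interior P \<noteq> {}"
      using \<epsilon> by (metis centre_in_ball disjoint_iff open_Int_closure_eq_empty open_ball)
    moreover have "open (ball z \<epsilon> \<inter> interior P)" by auto
    ultimately have "\<not> ball z \<epsilon> \<inter> interior P \<subseteq> {x. n \<bullet> x = c}"
      using interior_hyperplane[OF n, of c] interior_maximal by blast
    then obtain y where y: "y \<in> ball z \<epsilon>" "y \<in> P" "n \<bullet> y \<noteq> c"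
      using interior_subset by blast
    have "H1 \<inter> frontier P = {}" "H2 \<inter> frontier P = {}"
      using fr ec P unfolding H1_def H2_def by (fastforce simp: subset_iff)+
    then have "H1 \<inter> P \<noteq> {} \<Longrightarrow> H1 \<subseteq> P" "H2 \<inter> P \<noteq> {} \<Longrightarrow> H2 \<subseteq> P"
      using connected_Int_frontier[OF co(1), of P] connected_Int_frontier[OF co(2), of P] by auto
    moreover have "y \<in> H1 \<or> y \<in> H2" using y by (auto simp: H1_def H2_def)
    ultimately show ?thesis using y by blast
  qed
  have no: "\<not> (H \<noteq> {} \<and> H \<subseteq> Q \<and> H \<subseteq> Q')" if "open H" for H
    using that disj interior_maximal[of H "Q \<inter> Q'"] by blast
  have "H1 \<subseteq> Q \<union> Q'" "H2 \<subseteq> Q \<union> Q'"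
    using side[of Q] side[of Q'] no[OF op(1)] no[OF op(2)] by blast+
  then have sub: "ball z \<epsilon> - (Q \<union> Q') \<subseteq> {x. n \<bullet> x = c}"
    unfolding H1_def H2_def by (auto simp: subset_iff) (metis linorder_neqE_linordered_idom)+
  \<comment> \<open>What the two cells leave uncovered is open and lies on the line, so it is empty.\<close>
  have "open (ball z \<epsilon> - (Q \<union> Q'))"
    using Q polygon_closed by (intro open_Diff) auto
  then have "ball z \<epsilon> - (Q \<union> Q') = {}"
    using sub interior_hyperplane[OF n, of c] interior_maximal by blast
  then show ?thesis using \<epsilon> by (auto simp: mem_interior)
qed

section \<open>Meshes and the boundary of the domain\<close>

definition polygonal_mesh :: "(real^2) set \<Rightarrow> (real^2) set set \<Rightarrow> bool" where
  "polygonal_mesh \<Omega> G \<longleftrightarrow> finite G \<and> (\<forall>Q\<in>G. polygon Q) \<and> \<Union>G = closure \<Omega> \<and>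
     (\<forall>Q\<in>G. \<forall>Q'\<in>G. Q = Q' \<or> Q \<inter> Q' = {} \<or>
        (\<exists>a. Q \<inter> Q' = {a} \<and> a extreme_point_of Q \<and> a extreme_point_of Q') \<or>
        ((Q \<inter> Q') edge_of Q \<and> (Q \<inter> Q') edge_of Q'))"

lemma subdivision_imp_polygonal_mesh: "subdivision \<Omega> G \<Longrightarrow> polygonal_mesh \<Omega> G"
  unfolding subdivision_def polygonal_mesh_def using convex_quad_imp_polygon by meson

text \<open>The last assumption says that the domain lies on one side of its boundary. It excludes slits, on
  which an edge shared by two cells would be part of the boundary.\<close>

locale mesh =
  fixes \<Omega> :: "(real^2) set" and G :: "(real^2) set set"
  assumes mesh: "polygonal_mesh \<Omega> G"
    and open_domain: "open \<Omega>" and no_slits: "interior (closure \<Omega>) \<subseteq> \<Omega>"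
begin

lemma finite_cells: "finite G" and polygon_cell: "Q \<in> G \<Longrightarrow> polygon Q"
  and Union_cells: "\<Union>G = closure \<Omega>"
  using mesh by (auto simp: polygonal_mesh_def)

lemma cells_meet:
  assumes "Q \<in> G" "Q' \<in> G" "Q \<noteq> Q'" "x \<in> Q" "x \<in> Q'"
  obtains "Q \<inter> Q' = {x}" "x extreme_point_of Q" "x extreme_point_of Q'"
  | "(Q \<inter> Q') edge_of Q" "(Q \<inter> Q') edge_of Q'"
proof -
  have "(\<exists>a. Q \<inter> Q' = {a} \<and> a extreme_point_of Q \<and> a extreme_point_of Q') \<or>
        ((Q \<inter> Q') edge_of Q \<and> (Q \<inter> Q') edge_of Q')"
    using mesh assms unfolding polygonal_mesh_def by blast
  then show ?thesis
  proof
    assume "\<exists>a. Q \<inter> Q' = {a} \<and> a extreme_point_of Q \<and> a extreme_point_of Q'"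
    then obtain a where a: "Q \<inter> Q' = {a}" "a extreme_point_of Q" "a extreme_point_of Q'" by blast
    have "x \<in> {a}" using assms(4,5) unfolding a(1)[symmetric] by blast
    with a show ?thesis using that(1) by simp
  next
    assume "(Q \<inter> Q') edge_of Q \<and> (Q \<inter> Q') edge_of Q'"
    then show ?thesis using that(2) by blast
  qed
qed

lemma interior_cells_disjoint:
  assumes "Q \<in> G" "Q' \<in> G" "Q \<noteq> Q'" shows "interior (Q \<inter> Q') = {}"
proof (rule ccontr)
  assume ne: "interior (Q \<inter> Q') \<noteq> {}"
  then obtain x where x: "x \<in> Q" "x \<in> Q'" using interior_subset by blast
  have d: "aff_dim (Q \<inter> Q') = 2" using aff_dim_nonempty_interior[OF ne] by simp
  show False by (rule cells_meet[OF assms x]) (use d in \<open>auto simp: edge_of_def\<close>)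
qed

lemma interior_cell_subset: "Q \<in> G \<Longrightarrow> interior Q \<subseteq> \<Omega>"
  using interior_mono[of Q "closure \<Omega>"] Union_cells no_slits by blast

text \<open>The mesh resolves the boundary: every boundary point lies on a cell edge all of which is boundary.
  For a boundary point \<open>y\<close> that is no vertex, only one cell \<open>Q\<close> contains \<open>y\<close>, because two cells
  would share an edge through \<open>y\<close> and cover a neighbourhood of it. The same then holds for all
  other non-vertex points of the edge of \<open>Q\<close> through \<open>y\<close>, which are therefore boundary points as
  well. A vertex on none of these edges would be an isolated boundary point, and then a punctured
  disc around it would lie in the domain, contrary to the absence of slits.\<close>

theorem frontier_covered_by_edges:
  assumes "y \<in> frontier \<Omega>"
  shows "\<exists>Q\<in>G. \<exists>e. e edge_of Q \<and> e \<subseteq> frontier \<Omega> \<and> y \<in> e"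
proof -
  define V where "V = (\<Union>Q\<in>G. {x. x extreme_point_of Q})"
  define E where "E = {e. \<exists>Q\<in>G. e edge_of Q \<and> e \<subseteq> frontier \<Omega>}"
  have fV: "finite V" unfolding V_def using finite_cells finite_extreme_points polygon_cell by auto
  have "E \<subseteq> (\<Union>Q\<in>G. {e. e edge_of Q})" unfolding E_def by auto
  then have fE: "finite E" using finite_cells finite_edges polygon_cell by (meson finite_UN_I finite_subset)
  have fr: "frontier \<Omega> = closure \<Omega> - \<Omega>" using open_domain by (simp add: frontier_def interior_open)
  have generic: "y \<in> \<Union>E" if y: "y \<in> frontier \<Omega>" "y \<notin> V" for y
  proof -
    obtain Q where Q: "Q \<in> G" "y \<in> Q" using y Union_cells fr by blast
    have "y \<notin> interior Q" using interior_cell_subset[OF Q(1)] y fr by blast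
    then have "y \<in> frontier Q" using Q closure_subset by (auto simp: frontier_def)
    then obtain e where e: "e edge_of Q" "y \<in> e" using polygon_frontier[OF polygon_cell[OF Q(1)]] by blast
    have only: "y \<notin> Q'" if Q': "Q' \<in> G" "Q' \<noteq> Q" for Q'
    proof
      assume yQ': "y \<in> Q'"
      have "(Q \<inter> Q') edge_of Q" "(Q \<inter> Q') edge_of Q'"
        using cells_meet[OF Q(1) Q'(1) Q'(2)[symmetric] Q(2) yQ'] y(2) Q(1) unfolding V_def by blast+
      moreover have "\<not> y extreme_point_of Q" "\<not> y extreme_point_of Q'"
        using y(2) Q Q' by (auto simp: V_def)
      ultimately have "y \<in> interior (Q \<union> Q')"
        using Q Q' yQ' by (intro common_edge_interior[where e="Q \<inter> Q'"] polygon_cell interior_cells_disjoint) auto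
      moreover have "Q \<union> Q' \<subseteq> closure \<Omega>" using Union_cells Q Q' by blast
      ultimately show False using no_slits y(1) fr interior_mono by blast
    qed
    have "z \<in> frontier \<Omega>" if z: "z \<in> e" "z \<notin> V" for z
    proof -
      have zQ: "z \<in> Q" using z e edge_of_imp_subset by blast
      have away: "z \<notin> Q'" if Q': "Q' \<in> G" "Q' \<noteq> Q" for Q'
      proof
        assume zQ': "z \<in> Q'"
        have d: "(Q \<inter> Q') edge_of Q" "(Q \<inter> Q') edge_of Q'"
          using cells_meet[OF Q(1) Q'(1) Q'(2)[symmetric] zQ zQ'] z(2) Q(1) unfolding V_def by blast+
        have "\<not> z extreme_point_of Q" using z(2) Q(1) by (auto simp: V_def)
        then have "Q \<inter> Q' = e"
          using edges_meet_at_extreme_point[OF polygon_cell[OF Q(1)] d(1) e(1)] z zQ zQ' by blast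
        then show False using only[OF Q'] e(2) by blast
      qed
      have "closed (\<Union>(G - {Q}))"
        using finite_cells polygon_cell polygon_closed by (intro closed_Union) auto
      then have "open (\<Omega> - \<Union>(G - {Q}))" using open_domain by (intro open_Diff)
      moreover have "\<Omega> - \<Union>(G - {Q}) \<subseteq> Q" using Union_cells closure_subset by blast
      ultimately have "\<Omega> - \<Union>(G - {Q}) \<subseteq> interior Q" by (rule interior_maximal[rotated])
      moreover have "z \<notin> interior Q" using edge_not_in_interior[OF polygon_cell[OF Q(1)] e(1) z(1)] .
      ultimately have "z \<notin> \<Omega>" using away by blast
      then show ?thesis using fr zQ Q(1) Union_cells by blast
    qed
    then have sub: "e - V \<subseteq> frontier \<Omega>" by blast
    \<comment> \<open>The finitely many vertices on the edge are limits of its other points, and the boundary is closed.\<close>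
    obtain a b where ab: "e = closed_segment a b" using edge_is_segment[OF polygon_cell[OF Q(1)] e(1)] .
    have "a \<noteq> b" using edge_ends(1)[OF polygon_cell[OF Q(1)]] e(1) ab by blast
    have "e \<subseteq> frontier \<Omega>"
    proof
      fix z assume z: "z \<in> e"
      have "z islimpt e" unfolding ab
      proof (rule connected_imp_perfect)
        show "z \<in> closed_segment a b" using z ab by simp
        show "closed_segment a b \<noteq> {w}" for w using \<open>a \<noteq> b\<close> by (metis ends_in_segment singletonD)
      qed simp
      then have "z islimpt (V \<union> (e - V))" by (rule islimpt_subset) auto
      then have "z islimpt (e - V)" using islimpt_Un_finite[OF fV] by blast
      then have "z islimpt frontier \<Omega>" using sub by (rule islimpt_subset)
      then show "z \<in> frontier \<Omega>" using closed_limpt frontier_closed by blast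
    qed
    then show ?thesis using e Q(1) by (auto simp: E_def)
  qed
  have "y \<in> \<Union>E"
  proof (rule ccontr)
    assume nE: "y \<notin> \<Union>E"
    have "closed (\<Union>E)"
    proof (rule closed_Union)
      show "\<forall>e\<in>E. closed e" unfolding E_def using closed_edge polygon_cell by blast
    qed (rule fE)
    then have "closed (\<Union>E \<union> (V - {y}))" using fV by (simp add: closed_Un finite_imp_closed)
    then have "open (- (\<Union>E \<union> (V - {y})))" by (rule open_Compl)
    moreover have "y \<in> - (\<Union>E \<union> (V - {y}))" using nE by blast
    ultimately obtain \<epsilon> where \<epsilon>: "\<epsilon> > 0" "ball y \<epsilon> \<subseteq> - (\<Union>E \<union> (V - {y}))"
      using open_contains_ball by metis
    have iso: "(ball y \<epsilon> - {y}) \<inter> frontier \<Omega> = {}" using generic \<epsilon>(2) by blast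
    have con: "connected (ball y \<epsilon> - {y})" by (rule connected_punctured_ball) simp
    have "y \<in> closure \<Omega>" "y \<notin> \<Omega>" using assms fr by auto
    then have "ball y \<epsilon> \<inter> \<Omega> \<noteq> {}"
      using \<epsilon>(1) by (metis centre_in_ball disjoint_iff open_Int_closure_eq_empty open_ball)
    then have "(ball y \<epsilon> - {y}) \<inter> \<Omega> \<noteq> {}" using \<open>y \<notin> \<Omega>\<close> by blast
    then have "ball y \<epsilon> - {y} \<subseteq> \<Omega>" using connected_Int_frontier[OF con, of \<Omega>] iso by blast
    then have "ball y \<epsilon> \<subseteq> closure \<Omega>" using \<open>y \<in> closure \<Omega>\<close> closure_subset by blast
    then have "y \<in> interior (closure \<Omega>)" using \<epsilon>(1) by (auto simp: mem_interior)
    then show False using no_slits \<open>y \<notin> \<Omega>\<close> by blast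
  qed
  then show ?thesis by (auto simp: E_def)
qed

end

text \<open>Moving up from a boundary point, in the coordinates in which the domain lies below a graph, leads
  at once into an open set disjoint from the domain.\<close>

lemma lipschitz_domain_no_slits:
  assumes "lipschitz_domain \<Omega>" shows "interior (closure \<Omega>) \<subseteq> \<Omega>"
proof (rule ccontr)
  assume "\<not> ?thesis"
  then obtain x where x: "x \<in> interior (closure \<Omega>)" "x \<notin> \<Omega>" by blast
  have op: "open \<Omega>" using assms by (simp add: lipschitz_domain_def)
  have "x \<in> frontier \<Omega>" using x interior_subset op by (auto simp: frontier_def interior_open)
  then obtain U T g L where U: "open U" "x \<in> U" and T: "orthogonal_transformation (T :: real^2 \<Rightarrow> real^2)"
    and g: "lipschitz_on L UNIV (g :: real \<Rightarrow> real)" and eq: "\<Omega> \<inter> U = {y \<in> U. T y $ 2 < g (T y $ 1)}"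
    using assms unfolding lipschitz_domain_def by blast
  have gc: "continuous_on UNIV g" using g by (rule lipschitz_on_continuous_on)
  have lT: "linear T" using T by (rule orthogonal_transformation_linear)
  have Tc: "continuous_on UNIV T" using lT by (simp add: linear_continuous_on linear_conv_bounded_linear)
  define W where "W = {y \<in> U. T y $ 2 > g (T y $ 1)}"
  have "open W"
  proof -
    have "open {y. g (T y $ 1) < T y $ 2}"
      by (intro open_Collect_less continuous_intros continuous_on_compose2[OF gc] Tc) auto
    moreover have "W = U \<inter> {y. g (T y $ 1) < T y $ 2}" by (auto simp: W_def)
    ultimately show ?thesis using U by auto
  qed
  have "T y $ 2 < g (T y $ 1)" if "y \<in> \<Omega> \<inter> U" for y using that unfolding eq by blast
  then have "W \<inter> \<Omega> = {}" unfolding W_def by fastforce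
  then have W: "W \<inter> closure \<Omega> = {}" using \<open>open W\<close> by (simp add: open_Int_closure_eq_empty)
  have ge: "T x $ 2 \<ge> g (T x $ 1)" using x(2) U eq by (auto simp: not_less[symmetric])
  obtain w where w: "T w = axis 2 1" using orthogonal_transformation_surj[OF T] by (metis surjD)
  have "open (interior (closure \<Omega>) \<inter> U)" "x \<in> interior (closure \<Omega>) \<inter> U" using U x by auto
  then obtain \<epsilon> where \<epsilon>: "\<epsilon> > 0" "ball x \<epsilon> \<subseteq> interior (closure \<Omega>) \<inter> U"
    using open_contains_ball by metis
  define t where "t = \<epsilon> / (2 * (norm w + 1))"
  have t: "t > 0" using \<epsilon> by (simp add: t_def add_nonneg_pos)
  have "t * norm w \<le> t * (norm w + 1)" using t by simp
  also have "\<dots> = \<epsilon> / 2" unfolding t_def by (simp add: add_nonneg_eq_0_iff field_simps)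
  finally have "t * norm w < \<epsilon>" using \<epsilon> by simp
  then have "x + t *\<^sub>R w \<in> ball x \<epsilon>" using t by (simp add: dist_norm)
  then have in1: "x + t *\<^sub>R w \<in> closure \<Omega>" "x + t *\<^sub>R w \<in> U" using \<epsilon>(2) interior_subset by blast+
  have "T (x + t *\<^sub>R w) = T x + t *\<^sub>R axis 2 1" using lT w by (simp add: linear_add linear_scale)
  then have "T (x + t *\<^sub>R w) $ 1 = T x $ 1" "T (x + t *\<^sub>R w) $ 2 = T x $ 2 + t" by (simp_all add: axis_def)
  then have "x + t *\<^sub>R w \<in> W" using in1 ge t by (simp add: W_def)
  then show False using W in1 by blast
qed

section \<open>Matching vertex values\<close>

text \<open>The potential must live on a connected set rather than on the vertices, so vertex values are
  interpolated linearly along the edges. Gluing compares increments on the intersection of two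
  cells only, which is why \<open>q\<close> is specified on edges. The interpolation is well defined because a point on two
  edges is a vertex.\<close>

lemma edge_interpolation:
  fixes p :: "real^2 \<Rightarrow> real"
  assumes Q: "polygon Q"
  shows "\<exists>q. \<forall>a b t. closed_segment a b edge_of Q \<longrightarrow> 0 \<le> t \<longrightarrow> t \<le> 1 \<longrightarrow>
           q (linepath a b t) = (1 - t) * p a + t * p b"
proof -
  define rep where "rep y r \<longleftrightarrow> (\<exists>a b t. closed_segment a b edge_of Q \<and> 0 \<le> t \<and> t \<le> 1 \<and>
      y = linepath a b t \<and> r = (1 - t) * p a + t * p b)" for y r
  have extreme: "r = p y" if "rep y r" "y extreme_point_of Q" for y r
  proof -
    obtain a b t where ab: "closed_segment a b edge_of Q" and t: "0 \<le> t" "t \<le> 1"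
      and y: "y = linepath a b t" and r: "r = (1 - t) * p a + t * p b"
      using \<open>rep y r\<close> unfolding rep_def by blast
    have "y \<in> closed_segment a b" unfolding y using t by (auto simp: linepath_in_path)
    then have "y = a \<or> y = b" using edge_ends(4)[OF Q ab] that by blast
    moreover have "a \<noteq> b" by (rule edge_ends(1)[OF Q ab])
    moreover have "y - a = t *\<^sub>R (b - a)" "b - y = (1 - t) *\<^sub>R (b - a)"
      unfolding y linepath_def by (simp_all add: algebra_simps)
    ultimately have "(y = a \<and> t = 0) \<or> (y = b \<and> t = 1)" by auto
    then show ?thesis using r by auto
  qed
  have unique: "r = s" if "rep y r" "rep y s" for y r s
  proof (cases "y extreme_point_of Q")
    case True then show ?thesis using extreme that by blast
  next
    case False
    obtain a b t where ab: "closed_segment a b edge_of Q" and t: "0 \<le> t" "t \<le> 1"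
      and y: "y = linepath a b t" and r: "r = (1 - t) * p a + t * p b"
      using \<open>rep y r\<close> unfolding rep_def by blast
    obtain c d u where cd: "closed_segment c d edge_of Q" and u: "0 \<le> u" "u \<le> 1"
      and y': "y = linepath c d u" and s: "s = (1 - u) * p c + u * p d"
      using \<open>rep y s\<close> unfolding rep_def by blast
    have "y \<in> closed_segment a b" unfolding y using t by (auto simp: linepath_in_path)
    moreover have "y \<in> closed_segment c d" unfolding y' using u by (auto simp: linepath_in_path)
    ultimately have "closed_segment a b = closed_segment c d"
      using edges_meet_at_extreme_point[OF Q ab cd] False by blast
    then have "{a, b} = {c, d}" by simp
    moreover have ne: "a \<noteq> b" by (rule edge_ends(1)[OF Q ab])
    ultimately consider "a = c" "b = d" | "a = d" "b = c" by (auto simp: doubleton_eq_iff)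
    then show ?thesis
    proof cases
      case 1
      have "(t - u) *\<^sub>R (b - a) = 0" using y y' 1 by (simp add: linepath_def algebra_simps)
      then show ?thesis using 1 ne r s by simp
    next
      case 2
      have "(t - (1 - u)) *\<^sub>R (b - a) = 0" using y y' 2 by (simp add: linepath_def algebra_simps)
      then have "t = 1 - u" using ne by simp
      then show ?thesis using 2 r s by simp
    qed
  qed
  define q where "q y = (SOME r. rep y r)" for y
  have "q (linepath a b t) = (1 - t) * p a + t * p b"
    if "closed_segment a b edge_of Q" "0 \<le> t" "t \<le> 1" for a b t
  proof -
    have rep: "rep (linepath a b t) ((1 - t) * p a + t * p b)" using that unfolding rep_def by blast
    then have "rep (linepath a b t) (q (linepath a b t))" unfolding q_def by (rule someI)
    then show ?thesis using rep unique by blast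
  qed
  then show ?thesis by blast
qed

context mesh
begin

text \<open>The topological core. Let each cell carry vertex values whose increments along a common edge are
  the same from both sides, and vanish along boundary edges. Then the values on each cell can be
  shifted by a constant so that they match at all vertices and vanish on the boundary.

  The pieces to be glued are the cells, with interpolated values, together with the complement of
  the domain, with the value zero; they cover the whole plane. Near a point \<open>x\<close>, increments from
  \<open>x\<close> define a local function: two cells through \<open>x\<close> and \<open>y\<close> either meet only in \<open>x = y\<close> or
  share an edge containing both points. If \<open>y\<close> is outside the domain, it lies on a boundary edge
  which, for \<open>y\<close> close to \<open>x\<close>, also contains \<open>x\<close>, and so the increment is zero, as the value zero
  on the complement demands. Since the complement is connected, the glued function has a single
  value there, and this value is subtracted.\<close>

theorem vertex_potential:
  fixes p :: "(real^2) set \<Rightarrow> real^2 \<Rightarrow> real"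
  assumes conn: "connected (- \<Omega>)"
    and inner: "\<And>Q Q' a b. Q \<in> G \<Longrightarrow> Q' \<in> G \<Longrightarrow> Q \<noteq> Q' \<Longrightarrow> closed_segment a b edge_of Q \<Longrightarrow>
        closed_segment a b edge_of Q' \<Longrightarrow> p Q b - p Q a = p Q' b - p Q' a"
    and outer: "\<And>Q a b. Q \<in> G \<Longrightarrow> closed_segment a b edge_of Q \<Longrightarrow>
        closed_segment a b \<subseteq> frontier \<Omega> \<Longrightarrow> p Q a = p Q b"
  shows "\<exists>k. (\<forall>Q\<in>G. \<forall>Q'\<in>G. \<forall>a. a extreme_point_of Q \<and> a extreme_point_of Q' \<longrightarrow>
             p Q a + k Q = p Q' a + k Q') \<and>
           (\<forall>Q\<in>G. \<forall>a. a extreme_point_of Q \<and> a \<in> frontier \<Omega> \<longrightarrow> p Q a + k Q = 0)"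
proof -
  have fr: "frontier \<Omega> = closure \<Omega> - \<Omega>" using open_domain by (simp add: frontier_def interior_open)
  have "\<forall>Q\<in>G. \<exists>q. \<forall>a b t. closed_segment a b edge_of Q \<longrightarrow> 0 \<le> t \<longrightarrow> t \<le> 1 \<longrightarrow>
           q (linepath a b t) = (1 - t) * p Q a + t * p Q b"
    using edge_interpolation polygon_cell by blast
  then obtain q where q: "\<And>Q a b t. Q \<in> G \<Longrightarrow> closed_segment a b edge_of Q \<Longrightarrow> 0 \<le> t \<Longrightarrow> t \<le> 1 \<Longrightarrow>
           q Q (linepath a b t) = (1 - t) * p Q a + t * p Q b"
    using bchoice[of G] by (metis (no_types, lifting))
  have q_vertex: "q Q a = p Q a" if Qa: "Q \<in> G" "a extreme_point_of Q" for Q a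
  proof -
    obtain b where "closed_segment a b edge_of Q"
      using extreme_point_in_edge[OF polygon_cell[OF Qa(1)] Qa(2)] .
    from q[OF Qa(1) this, of 0] show ?thesis by (simp add: linepath_0')
  qed
  have q_edge: "\<exists>s. q Q y - q Q x = s * (p Q b - p Q a) \<and>
      (\<forall>Q'\<in>G. closed_segment a b edge_of Q' \<longrightarrow> q Q' y - q Q' x = s * (p Q' b - p Q' a))"
    if Qe: "Q \<in> G" "closed_segment a b edge_of Q"
      and xy: "x \<in> closed_segment a b" "y \<in> closed_segment a b" for Q a b x y
  proof -
    obtain t u where "0 \<le> t" "t \<le> 1" "x = linepath a b t" "0 \<le> u" "u \<le> 1" "y = linepath a b u"
      using xy unfolding closed_segment_def linepath_def by blast
    then have "\<forall>Q'\<in>G. closed_segment a b edge_of Q' \<longrightarrow> q Q' y - q Q' x = (u - t) * (p Q' b - p Q' a)"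
      using q by (auto simp: algebra_simps)
    then show ?thesis using Qe by blast
  qed
  have q_inner: "q Q y - q Q x = q Q' y - q Q' x"
    if Q: "Q \<in> G" "Q' \<in> G" and x: "x \<in> Q" "x \<in> Q'" and y: "y \<in> Q" "y \<in> Q'" for Q Q' x y
  proof (cases "Q = Q'")
    case False
    from Q False x show ?thesis
    proof (cases rule: cells_meet)
      case 1
      have "y \<in> {x}" using y unfolding 1(1)[symmetric] by blast
      then show ?thesis by simp
    next
      case 2
      obtain a b where ab: "Q \<inter> Q' = closed_segment a b"
        using edge_is_segment[OF polygon_cell[OF Q(1)] 2(1)] .
      then have e: "closed_segment a b edge_of Q" "closed_segment a b edge_of Q'" using 2 by auto
      have "x \<in> closed_segment a b" "y \<in> closed_segment a b" using x y ab by auto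
      then show ?thesis using q_edge[OF Q(1) e(1)] inner[OF Q False e] e(2) Q(2) by fastforce
    qed
  qed simp
  have q_outer: "q Q x = q Q y"
    if Q: "Q \<in> G" and e: "e edge_of Q" "e \<subseteq> frontier \<Omega>" and xy: "x \<in> e" "y \<in> e" for Q e x y
  proof -
    obtain a b where "e = closed_segment a b" using edge_is_segment[OF polygon_cell[OF Q] e(1)] .
    then show ?thesis using q_edge[of Q a b x y] outer[of Q a b] that by fastforce
  qed
  define E where "E = {e. \<exists>Q\<in>G. e edge_of Q \<and> e \<subseteq> frontier \<Omega>}"
  have "E \<subseteq> (\<Union>Q\<in>G. {e. e edge_of Q})" unfolding E_def by auto
  then have fE: "finite E" using finite_cells finite_edges polygon_cell by (meson finite_UN_I finite_subset)
  \<comment> \<open>The pieces are indexed by the sets themselves; the complement of the domain carries the value zero.\<close>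
  define qq where "qq K = (if K \<in> G then q K else (\<lambda>_. 0))" for K
  have notin: "- \<Omega> \<notin> G"
  proof
    assume "- \<Omega> \<in> G"
    then have "interior (- \<Omega>) \<subseteq> \<Omega>" "interior (- \<Omega>) \<noteq> {}"
      using interior_cell_subset polygon_interior[OF polygon_cell] by blast+
    then show False using interior_subset[of "- \<Omega>"] by blast
  qed
  have "\<exists>F. \<forall>K\<in>insert (- \<Omega>) G. \<exists>c. \<forall>x\<in>K. F x = qq K x + c"
  proof (rule glue_over_closed_cover[where K="\<lambda>K. K"])
    show "finite (insert (- \<Omega>) G)" using finite_cells by simp
    show "closed K" if "K \<in> insert (- \<Omega>) G" for K
      using that polygon_closed[OF polygon_cell] open_domain by auto
    show "connected K" if "K \<in> insert (- \<Omega>) G" for K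
      using that convex_connected[OF polygon_convex[OF polygon_cell]] conn by auto
    show "(\<Union>K\<in>insert (- \<Omega>) G. K) = UNIV" using Union_cells closure_subset by auto
    fix x
    \<comment> \<open>The increment from \<open>x\<close>, computed in any cell that contains both points; zero if there is none.\<close>
    define f where "f y = (if \<exists>Q\<in>G. x \<in> Q \<and> y \<in> Q
        then let Q = SOME Q. Q \<in> G \<and> x \<in> Q \<and> y \<in> Q in q Q y - q Q x else 0)" for y
    have f: "f y = q Q y - q Q x" if Q: "Q \<in> G" "x \<in> Q" "y \<in> Q" for Q y
    proof -
      define Q' where "Q' = (SOME Q. Q \<in> G \<and> x \<in> Q \<and> y \<in> Q)"
      have "Q' \<in> G \<and> x \<in> Q' \<and> y \<in> Q'" unfolding Q'_def by (rule someI) (use Q in blast)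
      moreover have "f y = q Q' y - q Q' x" unfolding f_def Q'_def Let_def using Q by auto
      ultimately show ?thesis using q_inner Q by metis
    qed
    have "\<forall>\<^sub>F y in nhds x. y \<in> e \<longrightarrow> x \<in> e" if "e \<in> E" for e
    proof (cases "x \<in> e")
      case False
      have "closed e" using that closed_edge polygon_cell unfolding E_def by blast
      then have "\<forall>\<^sub>F y in nhds x. y \<in> - e" using False by (intro eventually_nhds_in_open) auto
      then show ?thesis by eventually_elim simp
    qed simp
    then have "\<forall>\<^sub>F y in nhds x. \<forall>e\<in>E. y \<in> e \<longrightarrow> x \<in> e" using fE by (simp add: eventually_ball_finite)
    then have "\<forall>\<^sub>F y in nhds x. \<forall>K\<in>insert (- \<Omega>) G. x \<in> K \<longrightarrow> y \<in> K \<longrightarrow> f y = qq K y - qq K x"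
    proof eventually_elim
      case (elim y)
      have "f y = 0" if "y \<notin> \<Omega>"
      proof (cases "\<exists>Q\<in>G. x \<in> Q \<and> y \<in> Q")
        case True
        then have "y \<in> frontier \<Omega>" using that Union_cells fr by blast
        then obtain Q e where e: "Q \<in> G" "e edge_of Q" "e \<subseteq> frontier \<Omega>" "y \<in> e"
          using frontier_covered_by_edges by blast
        then have x: "x \<in> e" using elim by (auto simp: E_def)
        then have "x \<in> Q" "y \<in> Q" using e edge_of_imp_subset by blast+
        then show ?thesis using f[OF e(1)] q_outer[OF e(1,2,3) x e(4)] by simp
      qed (auto simp: f_def)
      then show ?case using f notin by (auto simp: qq_def)
    qed
    then show "\<exists>f. \<forall>\<^sub>F y in nhds x. \<forall>K\<in>insert (- \<Omega>) G. x \<in> K \<longrightarrow> y \<in> K \<longrightarrow> f y = qq K y - qq K x"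
      by blast
  qed
  then obtain F where F: "\<forall>K\<in>insert (- \<Omega>) G. \<exists>c. \<forall>x\<in>K. F x = qq K x + c" by blast
  then obtain c where c: "\<And>K x. K \<in> insert (- \<Omega>) G \<Longrightarrow> x \<in> K \<Longrightarrow> F x = qq K x + c K"
    using bchoice[OF F] by blast
  have cG: "p Q a + (c Q - c (- \<Omega>)) = F a - c (- \<Omega>)" if "Q \<in> G" "a extreme_point_of Q" for Q a
    using c[of Q a] q_vertex[OF that] that by (auto simp: qq_def extreme_point_of_def)
  have cO: "F a = c (- \<Omega>)" if "a \<in> frontier \<Omega>" for a
    using c[of "- \<Omega>" a] that notin fr by (auto simp: qq_def)
  show ?thesis
  proof (intro exI[of _ "\<lambda>Q. c Q - c (- \<Omega>)"] conjI ballI allI impI)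
    show "p Q a + (c Q - c (- \<Omega>)) = p Q' a + (c Q' - c (- \<Omega>))"
      if "Q \<in> G" "Q' \<in> G" "a extreme_point_of Q \<and> a extreme_point_of Q'" for Q Q' a
      using cG that by simp
    show "p Q a + (c Q - c (- \<Omega>)) = 0"
      if "Q \<in> G" "a extreme_point_of Q \<and> a \<in> frontier \<Omega>" for Q a
      using cG[of Q a] cO[of a] that by simp
  qed
qed

end

section \<open>Polynomials of degree one and two\<close>

text \<open>Explicit coefficient forms of \<open>P\<^sub>1\<close> and \<open>P\<^sub>2\<close>; on them differentiation, edge integration and
  the construction of a stream function are all coefficient arithmetic.\<close>

definition affine_fun :: "real \<Rightarrow> real \<Rightarrow> real \<Rightarrow> real^2 \<Rightarrow> real" where
  "affine_fun a b c x = a + b * x$1 + c * x$2"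

definition quadratic_fun :: "real \<Rightarrow> real \<Rightarrow> real \<Rightarrow> real \<Rightarrow> real \<Rightarrow> real \<Rightarrow> real^2 \<Rightarrow> real" where
  "quadratic_fun a b c d e f x = a + b * x$1 + c * x$2 + d * (x$1)^2 + e * (x$1 * x$2) + f * (x$2)^2"

lemma polys_1_iff: "p \<in> polys 1 \<longleftrightarrow> (\<exists>a b c. p = affine_fun a b c)"
proof
  assume "p \<in> polys 1"
  then obtain c where c: "\<And>x. p x = (\<Sum>i\<le>1. \<Sum>j\<le>1 - i. c i j * (x $ 1) ^ i * (x $ 2) ^ j)"
    unfolding polys_def by blast
  have "p = affine_fun (c 0 0) (c 1 0) (c 0 1)"
    by (rule ext) (simp add: c affine_fun_def)
  then show "\<exists>a b c. p = affine_fun a b c" by blast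
next
  assume "\<exists>a b c. p = affine_fun a b c"
  then obtain a b c where p: "p = affine_fun a b c" by blast
  define k where "k i j = (if i = 1 then b else if j = 1 then c else a)" for i j :: nat
  have "\<forall>x. p x = (\<Sum>i\<le>1. \<Sum>j\<le>1 - i. k i j * (x $ 1) ^ i * (x $ 2) ^ j)"
    by (simp add: p k_def affine_fun_def)
  then show "p \<in> polys 1" unfolding polys_def by blast
qed

lemma polys_2_iff: "p \<in> polys 2 \<longleftrightarrow> (\<exists>a b c d e f. p = quadratic_fun a b c d e f)"
proof
  assume "p \<in> polys 2"
  then obtain c where c: "\<And>x. p x = (\<Sum>i\<le>2. \<Sum>j\<le>2 - i. c i j * (x $ 1) ^ i * (x $ 2) ^ j)"
    unfolding polys_def by blast
  have "p = quadratic_fun (c 0 0) (c 1 0) (c 0 1) (c 2 0) (c 1 1) (c 0 2)"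
    by (rule ext) (simp add: c quadratic_fun_def numeral_2_eq_2 algebra_simps)
  then show "\<exists>a b c d e f. p = quadratic_fun a b c d e f" by blast
next
  assume "\<exists>a b c d e f. p = quadratic_fun a b c d e f"
  then obtain a b c d e f where p: "p = quadratic_fun a b c d e f" by blast
  define k where "k i j = (if i = 0 then (if j = 0 then a else if j = 1 then c else f)
      else if i = 1 then (if j = 0 then b else e) else d)" for i j :: nat
  have "\<forall>x. p x = (\<Sum>i\<le>2. \<Sum>j\<le>2 - i. k i j * (x $ 1) ^ i * (x $ 2) ^ j)"
    by (simp add: p k_def quadratic_fun_def numeral_2_eq_2 algebra_simps)
  then show "p \<in> polys 2" unfolding polys_def by blast
qed

lemma dir_deriv_eq: "(p has_derivative D) (at x) \<Longrightarrow> dir_deriv n p x = D n"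
  unfolding dir_deriv_def using frechet_derivative_at by metis

lemma dir_deriv_affine: "dir_deriv n (affine_fun a b c) x = b * n$1 + c * n$2"
proof (rule dir_deriv_eq)
  show "(affine_fun a b c has_derivative (\<lambda>n. b * n$1 + c * n$2)) (at x)"
    unfolding affine_fun_def
    by (auto intro!: derivative_eq_intros bounded_linear.has_derivative[OF bounded_linear_vec_nth])
qed

lemma dir_deriv_quadratic:
  "dir_deriv n (quadratic_fun a b c d e f) x =
     affine_fun b (2 * d) e x * n$1 + affine_fun c e (2 * f) x * n$2"
proof (rule dir_deriv_eq)
  show "(quadratic_fun a b c d e f has_derivative
      (\<lambda>n. affine_fun b (2 * d) e x * n$1 + affine_fun c e (2 * f) x * n$2)) (at x)"
    unfolding affine_fun_def quadratic_fun_def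
    by (auto intro!: derivative_eq_intros bounded_linear.has_derivative[OF bounded_linear_vec_nth]
      simp: fun_eq_iff algebra_simps)
qed

definition partial :: "2 \<Rightarrow> (real^2 \<Rightarrow> real) \<Rightarrow> real^2 \<Rightarrow> real" where
  "partial i p = dir_deriv (axis i 1) p"

lemma partial_quadratic:
  "partial 1 (quadratic_fun a b c d e f) = affine_fun b (2 * d) e"
  "partial 2 (quadratic_fun a b c d e f) = affine_fun c e (2 * f)"
  unfolding partial_def fun_eq_iff dir_deriv_quadratic by (simp_all add: axis_def)

lemma partial_affine:
  "partial 1 (affine_fun a b c) = (\<lambda>x. b)"
  "partial 2 (affine_fun a b c) = (\<lambda>x. c)"
  unfolding partial_def fun_eq_iff dir_deriv_affine by (simp_all add: axis_def)

lemma curl_eq: "curl p x $ 1 = partial 2 p x" "curl p x $ 2 = - partial 1 p x"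
  by (simp_all add: curl_def partial_def)

context
  fixes p :: "real^2 \<Rightarrow> real" assumes p: "p \<in> polys 2"
begin

lemma partial_polys: "partial i p \<in> polys 1"
proof -
  obtain a b c d e f where "p = quadratic_fun a b c d e f" using p unfolding polys_2_iff by blast
  then have "partial 1 p \<in> polys 1 \<and> partial 2 p \<in> polys 1"
    unfolding polys_1_iff partial_quadratic[symmetric] by (auto simp: partial_quadratic)
  then show ?thesis using exhaust_2[of i] by auto
qed

lemma dir_deriv_polys: "dir_deriv n p x = n$1 * partial 1 p x + n$2 * partial 2 p x"
  using p unfolding polys_2_iff by (auto simp: partial_quadratic dir_deriv_quadratic)

text \<open>The midpoint rule is exact for the affine derivative along the segment.\<close>

lemma increment_polys:
  "p b - p a = (b - a)$1 * partial 1 p (midpoint a b) + (b - a)$2 * partial 2 p (midpoint a b)"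
proof -
  obtain k l m c d e where q: "p = quadratic_fun k l m c d e" using p unfolding polys_2_iff by blast
  show ?thesis unfolding q partial_quadratic unfolding quadratic_fun_def affine_fun_def
    by (simp add: midpoint_def power2_eq_square field_simps)
qed

lemma partial_commute: "partial 1 (partial 2 p) = partial 2 (partial 1 p)"
  using p unfolding polys_2_iff by (auto simp: partial_quadratic partial_affine)

lemma polys_add_const: "(\<lambda>x. p x + k) \<in> polys 2" "partial i (\<lambda>x. p x + k) = partial i p"
proof -
  obtain a b c d e f where q: "p = quadratic_fun a b c d e f" using p unfolding polys_2_iff by blast
  have r: "(\<lambda>x. p x + k) = quadratic_fun (a + k) b c d e f"
    by (simp add: q fun_eq_iff quadratic_fun_def)
  then show "(\<lambda>x. p x + k) \<in> polys 2" unfolding polys_2_iff by blast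
  show "partial i (\<lambda>x. p x + k) = partial i p"
    unfolding r unfolding q using exhaust_2[of i] by (auto simp: partial_quadratic)
qed

end

lemma polys_1_uminus:
  assumes "g \<in> polys 1"
  shows "(\<lambda>x. - g x) \<in> polys 1" and "partial i (\<lambda>x. - g x) = (\<lambda>x. - partial i g x)"
proof -
  obtain a b c where g: "g = affine_fun a b c" using assms unfolding polys_1_iff by blast
  then have h: "(\<lambda>x. - g x) = affine_fun (- a) (- b) (- c)"
    by (simp add: fun_eq_iff affine_fun_def)
  then show "(\<lambda>x. - g x) \<in> polys 1" unfolding polys_1_iff by blast
  show "partial i (\<lambda>x. - g x) = (\<lambda>x. - partial i g x)"
    unfolding h unfolding g using exhaust_2[of i] by (auto simp: partial_affine)
qed

text \<open>A divergence-free affine field \<open>(g, h)\<close> has a quadratic stream function, obtained by integrating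
  the coefficients. The divergence is constant, so its value at a single point decides.\<close>

lemma curl_potential:
  assumes "g \<in> polys 1" "h \<in> polys 1" "partial 1 g x + partial 2 h x = 0"
  obtains p where "p \<in> polys 2" "partial 2 p = g" "partial 1 p = (\<lambda>x. - h x)"
proof -
  obtain a b c where g: "g = affine_fun a b c" using assms(1) unfolding polys_1_iff by blast
  obtain a' b' c' where h: "h = affine_fun a' b' c'" using assms(2) unfolding polys_1_iff by blast
  have c': "c' = - b" using assms(3) by (simp add: g h partial_affine)
  define p where "p = quadratic_fun 0 (- a') a (- b' / 2) b (c / 2)"
  show ?thesis
  proof (rule that)
    show "p \<in> polys 2" unfolding polys_2_iff p_def by blast
    show "partial 2 p = g" "partial 1 p = (\<lambda>x. - h x)"
      unfolding p_def partial_quadratic by (simp_all add: g h c' fun_eq_iff affine_fun_def)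
  qed
qed

lemma edge_integral_polys_1:
  assumes "g \<in> polys 1" shows "edge_integral a b g = dist a b * g (midpoint a b)"
proof -
  obtain k l m where g: "g = affine_fun k l m" using assms unfolding polys_1_iff by blast
  have g': "g (linepath a b t) = g a + t * (g b - g a)" for t
    by (simp add: g affine_fun_def linepath_def algebra_simps)
  define F where "F t = dist a b * (g a * t + (g b - g a) * t^2 / 2)" for t
  have "((\<lambda>t. g (linepath a b t) * dist a b) has_integral (F 1 - F 0)) {0..1}"
    unfolding g' F_def
    by (rule fundamental_theorem_of_calculus)
       (auto intro!: derivative_eq_intros
         simp: has_real_derivative_iff_has_vector_derivative[symmetric] field_simps)
  then have "edge_integral a b g = F 1 - F 0" unfolding edge_integral_def by (rule integral_unique)
  also have "\<dots> = dist a b * ((g a + g b) / 2)" by (simp add: F_def field_simps)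
  also have "(g a + g b) / 2 = g (midpoint a b)" by (simp add: g affine_fun_def midpoint_def field_simps)
  finally show ?thesis .
qed

lemma edge_average_polys_1: "g \<in> polys 1 \<Longrightarrow> a \<noteq> b \<Longrightarrow> edge_average a b g = g (midpoint a b)"
  by (simp add: edge_average_def edge_integral_polys_1)

lemma edge_integral_normal_derivative:
  assumes "p \<in> polys 2"
  shows "edge_integral a b (dir_deriv n p) =
    dist a b * (n$1 * partial 1 p (midpoint a b) + n$2 * partial 2 p (midpoint a b))"
proof -
  obtain k l m c d e where q: "p = quadratic_fun k l m c d e" using assms unfolding polys_2_iff by blast
  have "dir_deriv n p = affine_fun (l * n$1 + m * n$2) (2 * c * n$1 + d * n$2) (d * n$1 + 2 * e * n$2)"
    unfolding q fun_eq_iff dir_deriv_quadratic by (simp add: affine_fun_def algebra_simps)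
  then have "dir_deriv n p \<in> polys 1" unfolding polys_1_iff by blast
  then show ?thesis using dir_deriv_polys[OF assms] by (simp add: edge_integral_polys_1)
qed

text \<open>The bridge between the two spaces. For quadratics, the difference of the endpoint values fixes the
  tangential component of the gradient at the midpoint of the edge, and the integral of the normal
  derivative fixes the normal component. Since edge averages of affine functions are midpoint values,
  the continuity conditions of the Morley space amount to continuity of the edge averages of the
  curl.\<close>

lemma midpoint_gradient_unique:
  assumes p: "p \<in> polys 2" "p' \<in> polys 2" and ab: "a \<noteq> b"
    and inc: "p b - p a = p' b - p' a"
    and nor: "\<And>n. unit_normal a b n \<Longrightarrow>
      edge_integral a b (dir_deriv n p) = edge_integral a b (dir_deriv n p')"
  shows "partial i p (midpoint a b) = partial i p' (midpoint a b)"
proof -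
  let ?d = "dist a b"
  define u v where "u = (b - a)$1" and "v = (b - a)$2"
  have d: "?d > 0" using ab by simp
  have d2: "?d^2 = u^2 + v^2" unfolding u_def v_def
    unfolding dist_norm norm_minus_commute[of a b] power2_norm_eq_inner
    by (simp add: inner_vec_def sum_2 power2_eq_square)
  \<comment> \<open>The tangent turned clockwise by a right angle.\<close>
  define n :: "real^2" where "n = vector [v / ?d, - u / ?d]"
  have "(norm n)^2 = (u^2 + v^2) / ?d^2"
    unfolding power2_norm_eq_inner inner_vec_def
    by (simp add: n_def sum_2 power2_eq_square add_divide_distrib)
  then have "(norm n)^2 = 1" using d unfolding d2[symmetric] by simp
  then have "norm n = 1" using norm_ge_zero[of n] unfolding power2_eq_1_iff by linarith
  moreover have "n \<bullet> (b - a) = 0"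
  proof -
    have "n \<bullet> (b - a) = n$1 * u + n$2 * v" by (simp add: inner_vec_def sum_2 u_def v_def)
    then show ?thesis by (simp add: n_def)
  qed
  ultimately have "unit_normal a b n" by (simp add: unit_normal_def)
  from nor[OF this] have "?d * (n$1 * partial 1 p (midpoint a b) + n$2 * partial 2 p (midpoint a b)) =
      ?d * (n$1 * partial 1 p' (midpoint a b) + n$2 * partial 2 p' (midpoint a b))"
    using p by (simp add: edge_integral_normal_derivative)
  then have e1: "v * (partial 1 p (midpoint a b) - partial 1 p' (midpoint a b)) =
      u * (partial 2 p (midpoint a b) - partial 2 p' (midpoint a b))"
    using d by (simp add: n_def field_simps)
  have e2: "u * (partial 1 p (midpoint a b) - partial 1 p' (midpoint a b)) +
      v * (partial 2 p (midpoint a b) - partial 2 p' (midpoint a b)) = 0"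
    using inc unfolding increment_polys[OF p(1)] increment_polys[OF p(2)] u_def[symmetric] v_def[symmetric]
    by (simp add: algebra_simps)
  let ?x = "partial 1 p (midpoint a b) - partial 1 p' (midpoint a b)"
  let ?y = "partial 2 p (midpoint a b) - partial 2 p' (midpoint a b)"
  have "(u^2 + v^2) * ?x = 0" "(u^2 + v^2) * ?y = 0" using e1 e2 by algebra+
  then have "?x = 0" "?y = 0" using d d2 by auto
  then show ?thesis using exhaust_2[of i] by auto
qed

lemma polys_imp_real_polynomial_function:
  assumes "p \<in> polys k" shows "real_polynomial_function p"
proof -
  obtain c where p: "p = (\<lambda>x. \<Sum>i\<le>k. \<Sum>j\<le>k - i. c i j * (x $ 1) ^ i * (x $ 2) ^ j)"
    using assms unfolding polys_def by blast
  have coord: "real_polynomial_function (\<lambda>x::real^2. x $ i)" for i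
    by (intro real_polynomial_function.intros(1) bounded_linear_vec_nth)
  show ?thesis unfolding p
    by (intro real_polynomial_function_sum real_polynomial_function.intros(4) real_polynomial_function_power
        real_polynomial_function.intros(2) coord finite_atMost)
qed

lemma continuous_on_polys: "p \<in> polys k \<Longrightarrow> continuous_on S p"
  using continuous_on_polymonial_function polys_imp_real_polynomial_function real_polynomial_function_eq
  by blast

text \<open>On the line from a point of \<open>U\<close> to \<open>y\<close>, the function is a polynomial in one variable that
  vanishes on an infinite set of parameters.\<close>

lemma real_polynomial_function_eq_zero:
  fixes f :: "'a::real_normed_vector \<Rightarrow> real"
  assumes f: "real_polynomial_function f" and U: "open U" "U \<noteq> {}" and z: "\<And>x. x \<in> U \<Longrightarrow> f x = 0"
  shows "f y = 0"
proof -
  obtain x where x: "x \<in> U" using U by blast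
  define l where "l t = x + t *\<^sub>R (y - x)" for t :: real
  have "polynomial_function l" unfolding l_def
    by (intro polynomial_function_add polynomial_function_const polynomial_function_bounded_linear
        bounded_linear_scaleR_left)
  then have "real_polynomial_function (f \<circ> l)" using f by (rule real_polynomial_function_compose)
  then obtain a n where a: "f \<circ> l = (\<lambda>t. \<Sum>i\<le>n. a i * t ^ i)"
    unfolding real_polynomial_function_iff_sum by blast
  have "continuous_on UNIV l" unfolding l_def by (intro continuous_intros)
  then have "open (l -` U)" using U(1) by (simp add: open_vimage)
  moreover have "0 \<in> l -` U" using x by (simp add: l_def)
  ultimately have "infinite (l -` U)" using finite_imp_not_open by blast
  moreover have "l -` U \<subseteq> {t. (\<Sum>i\<le>n. a i * t ^ i) = 0}"
    using z fun_cong[OF a] by (auto simp del: neq0_conv) metis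
  ultimately have "\<forall>i\<le>n. a i = 0" using polyfun_finite_roots[of a n] finite_subset by blast
  then have "(f \<circ> l) 1 = 0" unfolding a by simp
  then show ?thesis by (simp add: l_def)
qed

lemma AE_lebesgue_on_iff:
  "S \<in> sets lebesgue \<Longrightarrow> (AE x in lebesgue_on S. P x) \<longleftrightarrow> (AE x in lebesgue. x \<in> S \<longrightarrow> P x)"
  by (subst AE_restrict_space_iff) auto

text \<open>A set of measure zero contains no nonempty open set, so the polynomials agree on the whole
  interior. Consequently the description defining \<open>cell_poly\<close> denotes.\<close>

lemma polys_AE_unique:
  assumes p: "p \<in> polys k" "p' \<in> polys k'" and S: "closed S" "interior S \<noteq> {}"
    and ae: "AE x in lebesgue_on S. p x = p' x"
  shows "p = p'"
proof
  fix y
  define f where "f x = p x - p' x" for x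
  have f: "real_polynomial_function f" unfolding f_def
    using p polys_imp_real_polynomial_function by (intro real_polynomial_function_diff) auto
  have cf: "continuous_on UNIV f" unfolding f_def
    using p by (intro continuous_on_diff continuous_on_polys) auto
  have Sm: "S \<in> sets lebesgue" using S(1) by simp
  have "open {x. f x \<noteq> 0}" using cf by (intro open_Collect_neq) (auto intro: continuous_on_const)
  then have op: "open (interior S \<inter> {x. f x \<noteq> 0})" by auto
  have "AE x in lebesgue. x \<in> S \<longrightarrow> f x = 0" using ae unfolding AE_lebesgue_on_iff[OF Sm] f_def by auto
  then obtain N where N: "negligible N" "{x. \<not> (x \<in> S \<longrightarrow> f x = 0)} \<subseteq> N"
    unfolding eventually_ae_filter negligible_iff_null_sets by auto
  have "negligible (interior S \<inter> {x. f x \<noteq> 0})"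
    by (rule negligible_subset[OF N(1)]) (use interior_subset N(2) in auto)
  then have "interior S \<inter> {x. f x \<noteq> 0} = {}" using open_not_negligible op by blast
  then have "f x = 0" if "x \<in> interior S" for x using that by blast
  then have "f y = 0" using real_polynomial_function_eq_zero[OF f open_interior S(2)] by blast
  then show "p y = p' y" by (simp add: f_def)
qed

lemma cell_poly_eqI:
  assumes "p \<in> polys k" "closed Q" "interior Q \<noteq> {}" "AE x in lebesgue_on Q. v x = p x"
  shows "cell_poly v Q = p"
  unfolding cell_poly_def
proof (rule the_equality)
  show "(\<exists>k. p \<in> polys k) \<and> (AE x in lebesgue_on Q. v x = p x)" using assms by blast
  fix p' assume p': "(\<exists>k. p' \<in> polys k) \<and> (AE x in lebesgue_on Q. v x = p' x)"
  then obtain k' where k': "p' \<in> polys k'" by blast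
  have "AE x in lebesgue_on Q. p' x = p x" using assms(4) p' by (auto elim!: eventually_elim2)
  then show "p' = p" using polys_AE_unique[OF k' assms(1-3)] by blast
qed

section \<open>Functions given cell by cell\<close>

text \<open>The common shape of the cellwise operators and of the representatives constructed below: a
  function for each cell, used in its interior, and zero on the null set of cell boundaries.\<close>

definition piecewise :: "(real^2) set set \<Rightarrow> ((real^2) set \<Rightarrow> real^2 \<Rightarrow> 'b::real_vector) \<Rightarrow> real^2 \<Rightarrow> 'b" where
  "piecewise G f x = (\<Sum>Q\<in>G. indicat_real (interior Q) x *\<^sub>R f Q x)"

lemma curl_h_piecewise: "curl_h G v = piecewise G (\<lambda>Q. curl (cell_poly v Q))"
  by (simp add: fun_eq_iff curl_h_def piecewise_def)

lemma div_h_piecewise: "div_h G w = piecewise G (\<lambda>Q x.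
    partial 1 (cell_poly (\<lambda>y. w y $ 1) Q) x + partial 2 (cell_poly (\<lambda>y. w y $ 2) Q) x)"
  by (simp add: fun_eq_iff div_h_def piecewise_def partial_def sum_2)

lemma piecewise_component: "piecewise G f x $ i = piecewise G (\<lambda>Q x. f Q x $ i) x"
  by (simp add: piecewise_def)

lemma piecewise_sq_integrable:
  assumes G: "finite G" "\<And>Q. Q \<in> G \<Longrightarrow> bounded Q" and \<Omega>: "open \<Omega>" "bounded \<Omega>"
    and f: "\<And>Q. Q \<in> G \<Longrightarrow> continuous_on UNIV (f Q)"
  shows "piecewise G f \<in> sq_integrable \<Omega>"
proof -
  have meas: "piecewise G f \<in> borel_measurable borel"
    unfolding piecewise_def
    using f by (intro borel_measurable_sum borel_measurable_scaleR borel_measurable_indicator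
        borel_measurable_continuous_onI) auto
  then have m: "piecewise G f \<in> borel_measurable (lebesgue_on \<Omega>)"
    by (intro measurable_restrict_space1 measurable_completion) simp
  have "\<exists>B. \<forall>x. \<bar>indicat_real (interior Q) x *\<^sub>R f Q x\<bar> \<le> B" if Q: "Q \<in> G" for Q
  proof -
    have "compact (f Q ` closure Q)"
      using f[OF Q] G(2)[OF Q] by (intro compact_continuous_image) (auto intro: continuous_on_subset)
    then obtain B where B: "\<And>x. x \<in> closure Q \<Longrightarrow> \<bar>f Q x\<bar> \<le> B"
      using compact_imp_bounded bounded_iff by (metis image_eqI real_norm_def)
    have "\<bar>indicat_real (interior Q) x *\<^sub>R f Q x\<bar> \<le> \<bar>B\<bar>" for x
    proof (cases "x \<in> interior Q")
      case True
      then have "x \<in> closure Q" using interior_subset closure_subset by blast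
      then show ?thesis using B[of x] True by simp
    qed simp
    then show ?thesis by blast
  qed
  then obtain B where B: "\<And>Q x. Q \<in> G \<Longrightarrow> \<bar>indicat_real (interior Q) x *\<^sub>R f Q x\<bar> \<le> B Q"
    by metis
  have bd: "\<bar>piecewise G f x\<bar> \<le> sum B G" for x
    unfolding piecewise_def by (rule order_trans[OF sum_abs]) (intro sum_mono B)
  have "integrable (lebesgue_on \<Omega>) (\<lambda>x. (piecewise G f x)\<^sup>2)"
  proof (rule integrableI_bounded_set[where A=\<Omega> and B="(sum B G)\<^sup>2"])
    have "\<Omega> \<in> lmeasurable" using \<Omega> by (rule lmeasurable_open[rotated])
    then show "\<Omega> \<in> sets (lebesgue_on \<Omega>)" "emeasure (lebesgue_on \<Omega>) \<Omega> < \<infinity>"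
      by (auto simp: emeasure_restrict_space fmeasurable_def sets_restrict_space_iff)
    show "(\<lambda>x. (piecewise G f x)\<^sup>2) \<in> borel_measurable (lebesgue_on \<Omega>)" using m by measurable
    have "norm ((piecewise G f x)\<^sup>2) \<le> (sum B G)\<^sup>2" for x
      using power_mono[OF bd[of x], of 2] by simp
    then show "AE x in lebesgue_on \<Omega>. x \<in> \<Omega> \<longrightarrow> norm ((piecewise G f x)\<^sup>2) \<le> (sum B G)\<^sup>2"
      by simp
    show "AE x in lebesgue_on \<Omega>. x \<notin> \<Omega> \<longrightarrow> (piecewise G f x)\<^sup>2 = 0"
      by (rule AE_I2) simp
  qed
  then show ?thesis using m by (simp add: sq_integrable_def)
qed

context mesh
begin

lemma cell_facts:
  assumes "Q \<in> G"
  shows "closed Q" "interior Q \<noteq> {}" "convex Q" "bounded Q" "Q \<in> sets lebesgue"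
  using polygon_closed[OF polygon_cell[OF assms]] polygon_interior[OF polygon_cell[OF assms]]
    polygon_convex[OF polygon_cell[OF assms]] compact_imp_bounded[OF polygon_compact[OF polygon_cell[OF assms]]]
  by auto

lemma piecewise_in_cell:
  assumes Q: "Q \<in> G" and x: "x \<in> interior Q" shows "piecewise G f x = f Q x"
proof -
  have "x \<notin> interior Q'" if "Q' \<in> G - {Q}" for Q'
    using interior_cells_disjoint[of Q Q'] that Q x by (auto simp: interior_Int)
  then have "(\<Sum>Q'\<in>G - {Q}. indicat_real (interior Q') x *\<^sub>R f Q' x) = 0"
    by (intro sum.neutral) auto
  then show ?thesis
    unfolding piecewise_def by (subst sum.remove[OF finite_cells Q]) (use x in simp)
qed

lemma AE_cell_interior:
  assumes "Q \<in> G" shows "AE x in lebesgue_on Q. x \<in> interior Q"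
proof -
  have "frontier Q \<in> null_sets lebesgue"
    using negligible_convex_frontier[OF cell_facts(3)[OF assms]] by (simp add: negligible_iff_null_sets)
  then have "AE x in lebesgue. x \<notin> frontier Q" by (rule AE_not_in)
  then have "AE x in lebesgue. x \<in> Q \<longrightarrow> x \<in> interior Q"
    by eventually_elim (use closure_subset in \<open>auto simp: frontier_def\<close>)
  then show ?thesis by (simp add: AE_lebesgue_on_iff cell_facts[OF assms])
qed

lemma AE_piecewise: "Q \<in> G \<Longrightarrow> AE x in lebesgue_on Q. piecewise G f x = f Q x"
  by (rule eventually_mono[OF AE_cell_interior]) (simp_all add: piecewise_in_cell)

lemma AE_domain_if_AE_cells:
  assumes "\<And>Q. Q \<in> G \<Longrightarrow> AE x in lebesgue_on Q. P x"
  shows "AE x in lebesgue_on \<Omega>. P x"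
proof -
  have "AE x in lebesgue. x \<in> Q \<longrightarrow> P x" if "Q \<in> G" for Q
    using assms[OF that] AE_lebesgue_on_iff[OF cell_facts(5)[OF that]] by blast
  then have "AE x in lebesgue. \<forall>Q\<in>G. x \<in> Q \<longrightarrow> P x"
    by (rule AE_finite_allI[OF finite_cells])
  then have "AE x in lebesgue. x \<in> \<Omega> \<longrightarrow> P x"
  proof eventually_elim
    case (elim x)
    then show ?case using Union_cells closure_subset by blast
  qed
  moreover have "\<Omega> \<in> sets lebesgue" using open_domain by simp
  ultimately show ?thesis by (simp add: AE_lebesgue_on_iff)
qed

lemma cell_poly_piecewise:
  assumes "Q \<in> G" "f Q \<in> polys k" shows "cell_poly (piecewise G f) Q = f Q"
  by (rule cell_poly_eqI[OF assms(2) cell_facts(1,2)[OF assms(1)] AE_piecewise[OF assms(1), of f]])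

lemma cellwise_polyD:
  assumes "cellwise_poly k G v" "Q \<in> G"
  shows "cell_poly v Q \<in> polys k" "AE x in lebesgue_on Q. v x = cell_poly v Q x"
proof -
  obtain p where p: "p \<in> polys k" "AE x in lebesgue_on Q. v x = p x"
    using assms unfolding cellwise_poly_def by blast
  then have "cell_poly v Q = p" using cell_poly_eqI cell_facts[OF assms(2)] by blast
  then show "cell_poly v Q \<in> polys k" "AE x in lebesgue_on Q. v x = cell_poly v Q x" using p by simp_all
qed

lemma cellwise_poly_piecewise:
  "(\<And>Q. Q \<in> G \<Longrightarrow> f Q \<in> polys k) \<Longrightarrow> cellwise_poly k G (piecewise G f)"
  unfolding cellwise_poly_def using AE_piecewise by blast

section \<open>The two inclusions\<close>

text \<open>The curl of a quadratic is affine and divergence-free, and its edge averages are the entries of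
  the midpoint gradient, which the degrees of freedom of the Morley space determine. On a boundary
  edge the comparison function is zero.\<close>

theorem curl_h_in_PS0_divfree:
  assumes bounded: "bounded \<Omega>" and v: "v \<in> RQM0 \<Omega> G"
  shows "curl_h G v \<in> PS0_divfree \<Omega> G"
proof -
  define p where "p = cell_poly v"
  note props = v[unfolded RQM0_def mem_Collect_eq, folded p_def, THEN conjunct2]
  note cw = props[THEN conjunct1] and props = props[THEN conjunct2]
  have p: "p Q \<in> polys 2" if "Q \<in> G" for Q using cellwise_polyD(1)[OF cw that] by (simp add: p_def)
  have vertex: "p Q a = p Q' a"
    if "Q \<in> G" "Q' \<in> G" "a extreme_point_of Q" "a extreme_point_of Q'" for Q Q' a
    by (rule props[THEN conjunct1, rule_format]) (use that in blast)+
  have vertex0: "p Q a = 0" if "Q \<in> G" "a extreme_point_of Q" "a \<in> frontier \<Omega>" for Q a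
    by (rule props[THEN conjunct2, THEN conjunct1, rule_format]) (use that in blast)+
  have normal: "edge_integral a b (dir_deriv n (p Q)) = edge_integral a b (dir_deriv n (p Q'))"
    if "Q \<in> G" "Q' \<in> G" "Q \<noteq> Q'" "closed_segment a b edge_of Q" "closed_segment a b edge_of Q'"
      "unit_normal a b n" for Q Q' a b n
    by (rule props[THEN conjunct2, THEN conjunct2, THEN conjunct1, rule_format]) (use that in blast)+
  have normal0: "edge_integral a b (dir_deriv n (p Q)) = 0"
    if "Q \<in> G" "closed_segment a b edge_of Q" "closed_segment a b \<subseteq> frontier \<Omega>" "unit_normal a b n" for Q a b n
    by (rule props[THEN conjunct2, THEN conjunct2, THEN conjunct2, rule_format]) (use that in blast)+
  define g where "g i = (\<lambda>Q x. curl (p Q) x $ i)" for i :: 2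
  have g12: "g 1 Q = partial 2 (p Q)" "g 2 Q = (\<lambda>x. - partial 1 (p Q) x)" for Q
    by (simp_all add: g_def curl_eq fun_eq_iff)
  have g: "g i Q \<in> polys 1" if "Q \<in> G" for i Q
  proof -
    have "(\<lambda>x. - partial 1 (p Q) x) \<in> polys 1"
      by (intro polys_1_uminus partial_polys p that)
    then show ?thesis using exhaust_2[of i] partial_polys[OF p[OF that]] by (auto simp: g12)
  qed
  have w: "(\<lambda>x. curl_h G v x $ i) = piecewise G (g i)" for i
    by (simp add: fun_eq_iff curl_h_piecewise piecewise_component g_def p_def)
  have cp: "cell_poly (\<lambda>x. curl_h G v x $ i) Q = g i Q" if "Q \<in> G" for i Q
    unfolding w using that g[OF that] by (rule cell_poly_piecewise)
  have "(\<lambda>x. curl_h G v x $ i) \<in> PS0 \<Omega> G" for i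
    unfolding PS0_def
  proof (intro CollectI conjI ballI allI impI)
    show "(\<lambda>x. curl_h G v x $ i) \<in> sq_integrable \<Omega>"
      unfolding w
      by (rule piecewise_sq_integrable[OF finite_cells cell_facts(4) open_domain bounded continuous_on_polys[OF g]])
    show "cellwise_poly 1 G (\<lambda>x. curl_h G v x $ i)"
      unfolding w using g by (rule cellwise_poly_piecewise)
  next
    fix Q Q' a b
    assume Q: "Q \<in> G" "Q' \<in> G"
      and e: "Q \<noteq> Q' \<and> closed_segment a b edge_of Q \<and> closed_segment a b edge_of Q'"
    note ends = edge_ends[OF polygon_cell[OF Q(1)], of a b] edge_ends[OF polygon_cell[OF Q(2)], of a b]
    have "partial j (p Q) (midpoint a b) = partial j (p Q') (midpoint a b)" for j
    proof (rule midpoint_gradient_unique)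
      show "p Q b - p Q a = p Q' b - p Q' a" using vertex Q e ends by metis
    qed (use p Q e ends normal in auto)
    then have "g i Q (midpoint a b) = g i Q' (midpoint a b)"
      using exhaust_2[of i] by (auto simp: g12)
    then show "edge_average a b (cell_poly (\<lambda>x. curl_h G v x $ i) Q) =
        edge_average a b (cell_poly (\<lambda>x. curl_h G v x $ i) Q')"
      using e ends(1) Q g by (simp add: cp edge_average_polys_1)
  next
    fix Q a b
    assume Q: "Q \<in> G" and e: "closed_segment a b edge_of Q \<and> closed_segment a b \<subseteq> frontier \<Omega>"
    note ends = edge_ends[OF polygon_cell[OF Q], of a b]
    have z: "(\<lambda>x::real^2. 0::real) = quadratic_fun 0 0 0 0 0 0" by (simp add: fun_eq_iff quadratic_fun_def)
    have z2: "(\<lambda>x::real^2. 0::real) \<in> polys 2" unfolding z polys_2_iff by blast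
    have pz: "partial j (\<lambda>x. 0) x = 0" for j x
      unfolding z using exhaust_2[of j] by (auto simp: partial_quadratic affine_fun_def)
    have "partial j (p Q) (midpoint a b) = partial j (\<lambda>x. 0) (midpoint a b)" for j
    proof (rule midpoint_gradient_unique[OF p[OF Q] z2])
      show "a \<noteq> b" using ends e by blast
      have "a \<in> frontier \<Omega>" "b \<in> frontier \<Omega>" using e ends_in_segment by blast+
      then show "p Q b - p Q a = 0 - 0" using vertex0 Q e ends by simp
      show "edge_integral a b (dir_deriv n (p Q)) = edge_integral a b (dir_deriv n (\<lambda>x. 0))"
        if "unit_normal a b n" for n
        using normal0 Q e that by (simp add: edge_integral_normal_derivative[OF z2] pz)
    qed
    then have "g i Q (midpoint a b) = 0"
      using exhaust_2[of i] by (auto simp: g12 pz)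
    then show "edge_average a b (cell_poly (\<lambda>x. curl_h G v x $ i) Q) = 0"
      using e ends(1) Q g by (simp add: cp edge_average_polys_1)
  qed
  moreover have "AE x in lebesgue_on \<Omega>. div_h G (curl_h G v) x = 0"
  proof (rule AE_domain_if_AE_cells)
    fix Q assume Q: "Q \<in> G"
    have neg: "partial 2 (\<lambda>x. - partial 1 (p Q) x) x = - partial 2 (partial 1 (p Q)) x" for x
      using polys_1_uminus(2)[OF partial_polys[OF p[OF Q]], of 2] by (simp only:)
    show "AE x in lebesgue_on Q. div_h G (curl_h G v) x = 0"
      unfolding div_h_piecewise using AE_cell_interior[OF Q]
      by eventually_elim (simp add: piecewise_in_cell[OF Q] cp[OF Q] g12 neg partial_commute[OF p[OF Q]])
  qed
  ultimately show ?thesis by (simp add: PS0_divfree_def)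
qed

text \<open>On each cell the field has a quadratic stream function \<open>p Q\<close>. The increment of \<open>p Q\<close> along an
  edge is the flux of the field through the edge, which depends only on its edge averages and is
  therefore the same from both sides and zero on the boundary. So \<open>vertex_potential\<close> supplies the
  constants that make the vertex values match. A shift by constants leaves the normal derivatives
  alone, and their edge integrals are determined by the edge averages of the field.\<close>

theorem divfree_is_curl_h:
  assumes bounded: "bounded \<Omega>" and conn: "connected (- \<Omega>)" and w: "w \<in> PS0_divfree \<Omega> G"
  shows "\<exists>v\<in>RQM0 \<Omega> G. AE x in lebesgue_on \<Omega>. curl_h G v x = w x"
proof -
  define g where "g i = cell_poly (\<lambda>x. w x $ i)" for i :: 2
  have wi: "(\<lambda>x. w x $ i) \<in> PS0 \<Omega> G" for i using w by (simp add: PS0_divfree_def)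
  then have cw: "cellwise_poly 1 G (\<lambda>x. w x $ i)" for i by (simp add: PS0_def)
  have g: "g i Q \<in> polys 1" if "Q \<in> G" for i Q
    unfolding g_def by (rule cellwise_polyD(1)[OF cw that])
  have wg: "AE x in lebesgue_on Q. w x $ i = g i Q x" if "Q \<in> G" for i Q
    unfolding g_def by (rule cellwise_polyD(2)[OF cw that])
  note props = wi[unfolded PS0_def mem_Collect_eq, THEN conjunct2, THEN conjunct2, folded g_def]
  have avg: "g i Q (midpoint a b) = g i Q' (midpoint a b)"
    if "Q \<in> G" "Q' \<in> G" "Q \<noteq> Q'" "closed_segment a b edge_of Q" "closed_segment a b edge_of Q'" for i Q Q' a b
  proof -
    have "a \<noteq> b" using edge_ends(1)[OF polygon_cell] that by blast
    moreover have "edge_average a b (g i Q) = edge_average a b (g i Q')"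
      by (rule props[THEN conjunct1, rule_format]) (use that in blast)+
    ultimately show ?thesis using g that by (simp add: edge_average_polys_1)
  qed
  have avg0: "g i Q (midpoint a b) = 0"
    if "Q \<in> G" "closed_segment a b edge_of Q" "closed_segment a b \<subseteq> frontier \<Omega>" for i Q a b
  proof -
    have "a \<noteq> b" using edge_ends(1)[OF polygon_cell] that by blast
    moreover have "edge_average a b (g i Q) = 0"
      by (rule props[THEN conjunct2, rule_format]) (use that in blast)+
    ultimately show ?thesis using g that by (simp add: edge_average_polys_1)
  qed
  have "\<exists>p. p \<in> polys 2 \<and> partial 2 p = g 1 Q \<and> partial 1 p = (\<lambda>x. - g 2 Q x)" if Q: "Q \<in> G" for Q
  proof -
    have "AE x in lebesgue_on \<Omega>. div_h G w x = 0" using w by (simp add: PS0_divfree_def)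
    moreover have "\<Omega> \<in> sets lebesgue" using open_domain by simp
    ultimately have "AE x in lebesgue. x \<in> \<Omega> \<longrightarrow> div_h G w x = 0" by (simp add: AE_lebesgue_on_iff)
    then obtain N where N: "negligible N" "{x. \<not> (x \<in> \<Omega> \<longrightarrow> div_h G w x = 0)} \<subseteq> N"
      unfolding eventually_ae_filter negligible_iff_null_sets by auto
    \<comment> \<open>A point of the cell at which the divergence vanishes: almost every point of the domain is one.\<close>
    have "\<not> interior Q \<subseteq> N"
      using open_not_negligible[OF open_interior cell_facts(2)[OF Q]] negligible_subset[OF N(1)] by blast
    then obtain x where x: "x \<in> interior Q" "x \<notin> N" by blast
    then have "div_h G w x = 0" using N(2) interior_cell_subset[OF Q] by blast
    then have "partial 1 (g 1 Q) x + partial 2 (g 2 Q) x = 0"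
      unfolding div_h_piecewise piecewise_in_cell[OF Q x(1)] g_def .
    from curl_potential[OF g[OF Q] g[OF Q] this] show ?thesis by blast
  qed
  then obtain p where p: "\<And>Q. Q \<in> G \<Longrightarrow> p Q \<in> polys 2"
    and p2: "\<And>Q. Q \<in> G \<Longrightarrow> partial 2 (p Q) = g 1 Q"
    and p1: "\<And>Q. Q \<in> G \<Longrightarrow> partial 1 (p Q) = (\<lambda>x. - g 2 Q x)" by metis
  have "\<exists>k. (\<forall>Q\<in>G. \<forall>Q'\<in>G. \<forall>a. a extreme_point_of Q \<and> a extreme_point_of Q' \<longrightarrow>
             p Q a + k Q = p Q' a + k Q') \<and>
           (\<forall>Q\<in>G. \<forall>a. a extreme_point_of Q \<and> a \<in> frontier \<Omega> \<longrightarrow> p Q a + k Q = 0)"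
  proof (rule vertex_potential[OF conn])
    show "p Q b - p Q a = p Q' b - p Q' a"
      if Q: "Q \<in> G" "Q' \<in> G" "Q \<noteq> Q'" "closed_segment a b edge_of Q" "closed_segment a b edge_of Q'" for Q Q' a b
      unfolding increment_polys[OF p[OF Q(1)], of b a] increment_polys[OF p[OF Q(2)], of b a]
        p1[OF Q(1)] p2[OF Q(1)] p1[OF Q(2)] p2[OF Q(2)] avg[OF Q] ..
    show "p Q a = p Q b"
      if Q: "Q \<in> G" "closed_segment a b edge_of Q" "closed_segment a b \<subseteq> frontier \<Omega>" for Q a b
      using increment_polys[OF p[OF Q(1)], of b a] avg0[OF Q] by (simp add: p1[OF Q(1)] p2[OF Q(1)])
  qed
  then obtain k where k: "\<And>Q Q' a. Q \<in> G \<Longrightarrow> Q' \<in> G \<Longrightarrow> a extreme_point_of Q \<Longrightarrow> a extreme_point_of Q' \<Longrightarrow>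
             p Q a + k Q = p Q' a + k Q'"
    and k0: "\<And>Q a. Q \<in> G \<Longrightarrow> a extreme_point_of Q \<Longrightarrow> a \<in> frontier \<Omega> \<Longrightarrow> p Q a + k Q = 0" by metis
  define P where "P Q x = p Q x + k Q" for Q x
  have P: "P Q \<in> polys 2" "partial 1 (P Q) = (\<lambda>x. - g 2 Q x)" "partial 2 (P Q) = g 1 Q" if "Q \<in> G" for Q
    unfolding P_def polys_add_const(2)[OF p[OF that]] using polys_add_const(1)[OF p[OF that]] p1 p2 that by auto
  define v where "v = piecewise G P"
  have cp: "cell_poly v Q = P Q" if "Q \<in> G" for Q
    unfolding v_def by (rule cell_poly_piecewise[where f=P, OF that P(1)[OF that]])
  have normal: "edge_integral a b (dir_deriv n (P Q)) =
      dist a b * (n$2 * g 1 Q (midpoint a b) - n$1 * g 2 Q (midpoint a b))" if "Q \<in> G" for Q a b n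
    by (simp add: edge_integral_normal_derivative[OF P(1)[OF that]] P(2,3)[OF that])
  have "v \<in> RQM0 \<Omega> G" unfolding RQM0_def
  proof (intro CollectI conjI ballI allI impI)
    show "v \<in> sq_integrable \<Omega>"
      unfolding v_def
      by (rule piecewise_sq_integrable[OF finite_cells cell_facts(4) open_domain bounded continuous_on_polys[OF P(1)]])
    show "cellwise_poly 2 G v" unfolding v_def using P(1) by (rule cellwise_poly_piecewise)
    show "cell_poly v Q a = cell_poly v Q' a"
      if "Q \<in> G" "Q' \<in> G" "a extreme_point_of Q \<and> a extreme_point_of Q'" for Q Q' a
      using k[of Q Q' a] that by (simp add: cp P_def)
    show "cell_poly v Q a = 0" if "Q \<in> G" "a extreme_point_of Q \<and> a \<in> frontier \<Omega>" for Q a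
      using k0[of Q a] that by (simp add: cp P_def)
    show "edge_integral a b (dir_deriv n (cell_poly v Q)) = edge_integral a b (dir_deriv n (cell_poly v Q'))"
      if "Q \<in> G" "Q' \<in> G" "Q \<noteq> Q' \<and> closed_segment a b edge_of Q \<and> closed_segment a b edge_of Q' \<and>
        unit_normal a b n" for Q Q' a b n
      using avg[of Q Q' a b] that by (simp add: cp normal)
    show "edge_integral a b (dir_deriv n (cell_poly v Q)) = 0"
      if "Q \<in> G" "closed_segment a b edge_of Q \<and> closed_segment a b \<subseteq> frontier \<Omega> \<and> unit_normal a b n" for Q a b n
      using avg0[of Q a b] that by (simp add: cp normal)
  qed
  moreover have "AE x in lebesgue_on \<Omega>. curl_h G v x = w x"
  proof (rule AE_domain_if_AE_cells)
    fix Q assume Q: "Q \<in> G"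
    show "AE x in lebesgue_on Q. curl_h G v x = w x"
      unfolding curl_h_piecewise using AE_cell_interior[OF Q] wg[OF Q, of 1] wg[OF Q, of 2]
    proof eventually_elim
      case (elim x)
      then show ?case by (simp add: piecewise_in_cell[OF Q] vec_eq_iff forall_2 curl_eq cp[OF Q] P[OF Q])
    qed
  qed
  ultimately show ?thesis by blast
qed

end

lemma ae_class_cong:
  assumes "AE x in lebesgue_on \<Omega>. f x = g x" shows "ae_class \<Omega> f = ae_class \<Omega> g"
proof -
  have "(AE x in lebesgue_on \<Omega>. h x = f x) \<longleftrightarrow> (AE x in lebesgue_on \<Omega>. h x = g x)" for h
    using assms by (auto elim!: eventually_elim2)
  then show ?thesis by (simp add: ae_class_def)
qed

theorem lemma12:
  fixes \<Omega> :: "(real^2) set"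
    and \<G> :: "(real^2) set set set"
    and G :: "(real^2) set set"
  assumes "lipschitz_domain \<Omega>" and "bounded \<Omega>" and "simply_connected \<Omega>"
    and "polygonal_boundary \<Omega>"
    and "\<And>H. H \<in> \<G> \<Longrightarrow> subdivision \<Omega> H" and "regular_family \<G>"
    and "G \<in> \<G>"
  shows "ae_class \<Omega> ` curl_h G ` RQM0 \<Omega> G = ae_class \<Omega> ` PS0_divfree \<Omega> G"
proof -
  have op: "open \<Omega>" using assms(1) by (simp add: lipschitz_domain_def)
  interpret mesh \<Omega> G
    using subdivision_imp_polygonal_mesh[OF assms(5)[OF assms(7)]] op lipschitz_domain_no_slits[OF assms(1)]
    by unfold_locales
  have conn: "connected (- \<Omega>)" using op assms(2,3) by (rule connected_Compl_of_simply_connected)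
  show ?thesis
  proof (intro subset_antisym subsetI)
    fix c assume "c \<in> ae_class \<Omega> ` curl_h G ` RQM0 \<Omega> G"
    then show "c \<in> ae_class \<Omega> ` PS0_divfree \<Omega> G" using curl_h_in_PS0_divfree[OF assms(2)] by blast
  next
    fix c assume "c \<in> ae_class \<Omega> ` PS0_divfree \<Omega> G"
    then obtain w where w: "w \<in> PS0_divfree \<Omega> G" "c = ae_class \<Omega> w" by blast
    then obtain v where v: "v \<in> RQM0 \<Omega> G" "AE x in lebesgue_on \<Omega>. curl_h G v x = w x"
      using divfree_is_curl_h[OF assms(2) conn] by blast
    then have "c = ae_class \<Omega> (curl_h G v)" using w(2) ae_class_cong by blast
    then show "c \<in> ae_class \<Omega> ` curl_h G ` RQM0 \<Omega> G" using v(1) by blast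
  qed
qed

end
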